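(* Let $\alpha\ge0$ and let $q$ be an $\alpha$-LDP mechanism from an open subset $\mathcal{X}\subset\mathbb{R}^d$ to a finite or countable space $\mathcal{Z}$. Then there exist a non-negative Radon measure $\mu$ on $\mathcal{E}$, satisfying $\int_{\mathcal{E}}e_x(r)\,\mu(dr)=1$ for almost every $x\in\mathcal{X}$, and a randomization mechanism $q^{(2)}$ from $\mathcal{E}$ to $\mathcal{Z}$, such that $q$ admits the factorization $$q=q^{(2)}\circ q^{(\mu)},\qquad\text{where } q^{(\mu)}_x(dr)=e_x(r)\,\mu(dr),$$ that is, for all $z\in\mathcal{Z}$ and almost every $x\in\mathcal{X}$, $q_x(z)=\int_{\mathcal{E}}q^{(2)}_r(z)\,e_x(r)\,\mu(dr)$. Moreover $e^{-\alpha}\le\mu(\mathcal{E})\le1$.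
   Context: "Almost every" refers to Lebesgue measure. A randomization mechanism from $\mathcal{X}$ to a finite or countable $\mathcal{Z}$ is a family $q_x(z)=P(Z=z\mid X=x)$, measurable in $x$, with $q_x$ a probability mass function on $\mathcal{Z}$; it is $\alpha$-LDP if for all $z\in\mathcal{Z}$, $q_x(z)\le e^\alpha q_{x'}(z)$ for $dx\,dx'$-almost every $(x,x')$. A randomization mechanism $q^{(2)}$ from $\mathcal{E}$ to $\mathcal{Z}$ is a family $(q^{(2)}_r)_{r\in\mathcal{E}}$ of probability mass functions on $\mathcal{Z}$ such that $r\mapsto q^{(2)}_r(z)$ is measurable for every $z$. Let $C=\{v:\mathcal{X}\to\mathbb{R}\text{ measurable}: 1\le v(x)\le e^\alpha\text{ a.e.}\}\subset L^\infty(\mathcal{X},\mathbb{R})$, equipped with the weak-$\star$ topology $\sigma(L^\infty,L^1)$ (for which it is compact and metrizable) and its Borel $\sigma$-algebra, and let $\mathcal{E}=\{r:\mathcal{X}\to\mathbb{R}\text{ measurable}: r(x)\in\{1,e^\alpha\}\text{ a.e.}\}\subset C$, which is the set of extreme points of $C$ and a Borel ($G_\delta$) subset of $C$. Functions are identified when equal a.e. Evaluation operator: for $x\in\mathcal{X}$ and $r\in L^\infty(\mathcal{X})$ with $|r|\le e^\alpha$ a.e., $e_x(r)=\limsup_{\epsilon\to0}\frac{1}{|B(x,\epsilon)|}\int_{B(x,\epsilon)\cap\mathcal{X}}r(y)\,dy$, where $B(x,\epsilon)$ is the ball of radius $\epsilon$ centred at $x$ and $|\cdot|$ is Lebesgue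 measure. It is jointly measurable in $(x,r)$, and for each $r$, $e_x(r)=r(x)$ for a.e. $x$. *)

theory Defs
  imports "HOL-Probability.Probability"
begin

text \<open>
  A mechanism is a kernel given by probability mass functions on a countable type (which may be
  finite). Only its values on the space of \<open>M\<close> matter.
\<close>

definition randomization_mechanism :: "'b measure \<Rightarrow> ('b \<Rightarrow> 'z pmf) \<Rightarrow> bool" where
  "randomization_mechanism M q \<longleftrightarrow> (\<forall>z. (\<lambda>x. pmf (q x) z) \<in> borel_measurable M)"

definition LDP :: "real \<Rightarrow> 'a::euclidean_space set \<Rightarrow> ('a \<Rightarrow> 'z pmf) \<Rightarrow> bool" where
  "LDP \<alpha> X q \<longleftrightarrow> randomization_mechanism (lebesgue_on X) q \<and>
     (\<forall>z. AE (x, x') in lebesgue_on (X \<times> X). pmf (q x) z \<le> exp \<alpha> * pmf (q x') z)"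

text \<open>
  Elements of $L^\infty(X)$ are genuine equivalence classes, i.e. sets of functions. The functions
  are defined on the whole type, but neither measurability nor almost everywhere equality with
  respect to \<open>lebesgue_on X\<close> depends on their values outside \<open>X\<close>.
\<close>

definition ae_class :: "'a::euclidean_space set \<Rightarrow> ('a \<Rightarrow> real) \<Rightarrow> ('a \<Rightarrow> real) set" where
  "ae_class X f = {g \<in> borel_measurable (lebesgue_on X). AE x in lebesgue_on X. g x = f x}"

definition Linfty :: "'a::euclidean_space set \<Rightarrow> ('a \<Rightarrow> real) set set" where
  "Linfty X = ae_class X ` {f \<in> borel_measurable (lebesgue_on X).
                              \<exists>B. AE x in lebesgue_on X. \<bar>f x\<bar> \<le> B}"

definition rep :: "('a \<Rightarrow> real) set \<Rightarrow> 'a \<Rightarrow> real" where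
  "rep r = (SOME f. f \<in> r)"

definition pairing :: "'a::euclidean_space set \<Rightarrow> ('a \<Rightarrow> real) \<Rightarrow> ('a \<Rightarrow> real) set \<Rightarrow> real" where
  "pairing X g r = (\<integral>x. rep r x * g x \<partial>lebesgue_on X)"

text \<open>
  The coarsest topology on $L^\infty(X)$ for which \<open>pairing X g\<close> is continuous for every $g$ in
  $L^1(X)$.
\<close>

definition weak_star :: "'a::euclidean_space set \<Rightarrow> ('a \<Rightarrow> real) set topology" where
  "weak_star X = topology_generated_by
     {{r \<in> Linfty X. pairing X g r \<in> U} | g U. integrable (lebesgue_on X) g \<and> open U}"

definition C_set :: "real \<Rightarrow> 'a::euclidean_space set \<Rightarrow> ('a \<Rightarrow> real) set set" where
  "C_set \<alpha> X = ae_class X ` {v \<in> borel_measurable (lebesgue_on X).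
                               AE x in lebesgue_on X. 1 \<le> v x \<and> v x \<le> exp \<alpha>}"

definition E_set :: "real \<Rightarrow> 'a::euclidean_space set \<Rightarrow> ('a \<Rightarrow> real) set set" where
  "E_set \<alpha> X = ae_class X ` {r \<in> borel_measurable (lebesgue_on X).
                               AE x in lebesgue_on X. r x \<in> {1, exp \<alpha>}}"

definition C_top :: "real \<Rightarrow> 'a::euclidean_space set \<Rightarrow> ('a \<Rightarrow> real) set topology" where
  "C_top \<alpha> X = subtopology (weak_star X) (C_set \<alpha> X)"

definition E_top :: "real \<Rightarrow> 'a::euclidean_space set \<Rightarrow> ('a \<Rightarrow> real) set topology" where
  "E_top \<alpha> X = subtopology (C_top \<alpha> X) (E_set \<alpha> X)"

definition borel_of :: "'b topology \<Rightarrow> 'b measure" where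
  "borel_of T = sigma (topspace T) {U. openin T U}"

text \<open>
  Positive Radon measures on a Hausdorff space: locally finite Borel measures that are inner
  regular with respect to compact sets.
\<close>

definition radon_measure :: "'b topology \<Rightarrow> 'b measure \<Rightarrow> bool" where
  "radon_measure T M \<longleftrightarrow>
     sets M = sets (borel_of T) \<and>
     (\<forall>x\<in>topspace T. \<exists>U. openin T U \<and> x \<in> U \<and> emeasure M U < \<infinity>) \<and>
     (\<forall>A\<in>sets M. emeasure M A = (SUP K\<in>{K. compactin T K \<and> K \<subseteq> A}. emeasure M K))"

text \<open>
  The limit superior is taken in the extended reals. For $x$ in an open set $X$ and essentially
  bounded $f$ it is finite, so the conversion to \<open>real\<close> loses nothing.
\<close>

definition eval_fun :: "'a::euclidean_space set \<Rightarrow> 'a \<Rightarrow> ('a \<Rightarrow> real) \<Rightarrow> real" where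
  "eval_fun X x f = real_of_ereal (Limsup (at_right 0)
     (\<lambda>\<epsilon>. ereal (1 / measure lebesgue (ball x \<epsilon>) * (LINT y:ball x \<epsilon> \<inter> X|lebesgue. f y))))"

definition eval_at :: "'a::euclidean_space set \<Rightarrow> 'a \<Rightarrow> ('a \<Rightarrow> real) set \<Rightarrow> real" where
  "eval_at X x r = eval_fun X x (rep r)"

definition q_mu :: "'a::euclidean_space set \<Rightarrow> ('a \<Rightarrow> real) set measure \<Rightarrow> 'a
    \<Rightarrow> ('a \<Rightarrow> real) set measure" where
  "q_mu X \<mu> x = density \<mu> (\<lambda>r. ennreal (eval_at X x r))"

lemma rep_ae_class:
  assumes "f \<in> borel_measurable (lebesgue_on X)"
  shows "rep (ae_class X f) \<in> borel_measurable (lebesgue_on X)"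
    and "AE x in lebesgue_on X. rep (ae_class X f) x = f x"
proof -
  have "f \<in> ae_class X f"
    using assms by (simp add: ae_class_def)
  then have "rep (ae_class X f) \<in> ae_class X f"
    unfolding rep_def by (rule someI[of "\<lambda>h. h \<in> ae_class X f"])
  then show "rep (ae_class X f) \<in> borel_measurable (lebesgue_on X)"
    and "AE x in lebesgue_on X. rep (ae_class X f) x = f x"
    by (simp_all add: ae_class_def)
qed

lemma ae_class_eq_iff:
  assumes "f \<in> borel_measurable (lebesgue_on X)" "g \<in> borel_measurable (lebesgue_on X)"
  shows "ae_class X f = ae_class X g \<longleftrightarrow> (AE x in lebesgue_on X. f x = g x)"
proof
  assume "ae_class X f = ae_class X g"
  moreover have "f \<in> ae_class X f"
    using assms by (simp add: ae_class_def)
  ultimately show "AE x in lebesgue_on X. f x = g x"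
    by (simp add: ae_class_def)
next
  assume eq: "AE x in lebesgue_on X. f x = g x"
  have "(AE x in lebesgue_on X. h x = f x) \<longleftrightarrow> (AE x in lebesgue_on X. h x = g x)" for h
    using eq by (auto elim: AE_mp)
  then show "ae_class X f = ae_class X g"
    by (simp add: ae_class_def)
qed

lemma pairing_ae_class:
  assumes "f \<in> borel_measurable (lebesgue_on X)" "g \<in> borel_measurable (lebesgue_on X)"
  shows "pairing X g (ae_class X f) = (\<integral>x. f x * g x \<partial>lebesgue_on X)"
  unfolding pairing_def
proof (rule integral_cong_AE)
  show "AE x in lebesgue_on X. rep (ae_class X f) x * g x = f x * g x"
    using rep_ae_class(2)[OF assms(1)] by eventually_elim simp
qed (use assms rep_ae_class(1)[OF assms(1)] in measurable)

lemma eval_at_ae_class: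
  assumes "open X" "f \<in> borel_measurable (lebesgue_on X)"
  shows "eval_at X x (ae_class X f) = eval_fun X x f"
proof -
  let ?h = "rep (ae_class X f)"
  have X: "X \<in> sets lebesgue"
    using assms(1) by auto
  have "(LINT y:ball x e \<inter> X|lebesgue. ?h y) = (LINT y:ball x e \<inter> X|lebesgue. f y)" for e
  proof -
    have *: "set_borel_measurable lebesgue (ball x e \<inter> X) k"
      if "k \<in> borel_measurable (lebesgue_on X)" for k :: "'a \<Rightarrow> real"
    proof -
      have "set_borel_measurable lebesgue X k"
        using that X by (simp add: set_borel_measurable_def borel_measurable_restrict_space_iff)
      then show ?thesis
        by (rule set_borel_measurable_subset) (use X in auto)
    qed
    have "AE y in lebesgue. y \<in> X \<longrightarrow> ?h y = f y"
      using rep_ae_class(2)[OF assms(2)] X by (simp add: AE_restrict_space_iff)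
    then have "AE y in lebesgue. y \<in> ball x e \<inter> X \<longrightarrow> ?h y = f y"
      by eventually_elim simp
    then have "AE y in lebesgue. indicator (ball x e \<inter> X) y *\<^sub>R ?h y
                 = indicator (ball x e \<inter> X) y *\<^sub>R f y"
      by eventually_elim (auto simp: indicator_def)
    then show ?thesis
      unfolding set_lebesgue_integral_def
      using *[OF rep_ae_class(1)[OF assms(2)]] *[OF assms(2)]
      by (intro integral_cong_AE) (simp_all add: set_borel_measurable_def)
  qed
  then show ?thesis
    by (simp add: eval_at_def eval_fun_def)
qed

lemma C_set_subset_Linfty: "C_set \<alpha> X \<subseteq> Linfty X"
proof -
  have "\<exists>B. AE x in lebesgue_on X. \<bar>v x\<bar> \<le> B"
    if "AE x in lebesgue_on X. 1 \<le> v x \<and> v x \<le> exp \<alpha>" for v :: "'a \<Rightarrow> real"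
    by (rule exI[of _ "exp \<alpha>"]) (use that in \<open>eventually_elim, auto\<close>)
  then show ?thesis
    unfolding C_set_def Linfty_def by blast
qed

lemma E_set_subset_C_set:
  assumes "\<alpha> \<ge> 0"
  shows "E_set \<alpha> X \<subseteq> C_set \<alpha> X"
proof -
  have "AE x in lebesgue_on X. 1 \<le> r x \<and> r x \<le> exp \<alpha>"
    if "AE x in lebesgue_on X. r x \<in> {1, exp \<alpha>}" for r :: "'a \<Rightarrow> real"
    using that by eventually_elim (use assms in auto)
  then show ?thesis
    unfolding C_set_def E_set_def by blast
qed

lemma topspace_weak_star: "topspace (weak_star X) = Linfty X"
proof -
  let ?S = "{{r \<in> Linfty X. pairing X g r \<in> U} | g U. integrable (lebesgue_on X) g \<and> open U}"
  have "Linfty X = {r \<in> Linfty X. pairing X (\<lambda>_. 0) r \<in> UNIV}"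
    by simp
  moreover have "integrable (lebesgue_on X) (\<lambda>_. 0::real)"
    by simp
  ultimately have "Linfty X \<in> ?S"
    using open_UNIV by blast
  then have "\<Union>?S = Linfty X"
    by blast
  then show ?thesis
    by (simp add: weak_star_def topology_generated_by_topspace)
qed

lemma topspace_E_top: "\<alpha> \<ge> 0 \<Longrightarrow> topspace (E_top \<alpha> X) = E_set \<alpha> X"
  using E_set_subset_C_set[of \<alpha> X] C_set_subset_Linfty[of \<alpha> X]
  by (auto simp: E_top_def C_top_def topspace_weak_star)

end

theory Submission
  imports Defs
begin

text \<open>
  The set $E$ consists of the extreme points of $C$, so an integral representation over $E$ is an
  instance of Choquet's theorem. Here the representing measure is explicit: it comes from the
  layer-cake formula, without a compactness or convexity argument. Write $c = e^\alpha - 1$.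

  \<^item> The LDP condition says that for each $z$ the function $x \mapsto q_x(z)$ stays, almost
    everywhere, between some $m_z \ge 0$ and $e^\alpha m_z$. Hence $q_x(z) = m_z (1 + c\,u_z(x))$
    for a measurable $u_z$ with values in $[0,1]$, and summing over $z$ gives
    $e^{-\alpha} \le \sum_z m_z \le 1$ (\<open>LDP_affine_decomposition\<close>).
  \<^item> Since $u_z(x) = \int_0^1 1_{\{s < u_z(x)\}}\,ds$, the function $1 + c\,u_z$ is the average over
    $s \in [0,1]$ of the functions $r_{z,s} = 1 + c\,1_{\{s < u_z\}}$, all of which represent elements
    of $E$. The measure $\mu$ is the image of $\sum_z m_z\,\delta_z \otimes ds$ under
    $(z,s) \mapsto r_{z,s}$, and $q^{(2)}_r(z)$ is the conditional probability of $z$ given $r$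
    (\<open>conditional_pmf_exists\<close>). The total mass of $\mu$ is
    $\sum_z m_z$.
  \<^item> The factorization reduces to $e_x(r_{z,s}) = r_{z,s}(x)$ for almost every $x$, all $z$, and all
    $s \ne u_z(x)$ (\<open>AE_eval_at_level_class\<close>). For one $s$ this is the Lebesgue density theorem,
    proved from the Vitali covering theorem (\<open>lebesgue_density\<close>). It holds simultaneously for all
    rational $s$, and both sides are decreasing in $s$, which gives the remaining $s$. In
    particular the joint measurability of $e_x(r)$ is not needed; measurability in $r$ alone
    follows since $e_x$ is a countable infimum of suprema of continuous functionals
    (\<open>borel_measurable_eval_at\<close>).
  \<^item> The map $s \mapsto r_{z,s}$ is weak-star continuous except at the countably many $s$ for which
    $\{u_z = s\}$ has positive measure. Therefore $\mu$ inherits inner regularity from finite Borel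
    measures on the real line (\<open>radon_measure_distr\<close>).
\<close>

section \<open>The Lebesgue density theorem\<close>

text \<open>
  The points of \<open>S\<close> around which arbitrarily small balls contain at least a fraction \<open>\<delta>\<close> of
  mass outside \<open>S\<close> are covered, up to a null set, by disjoint such balls inside an open set
  \<open>U\<close> slightly larger than \<open>S\<close>; their total measure is at most
  $\delta^{-1} |U \setminus S|$.
\<close>

lemma lebesgue_density_upper:
  fixes S :: "'a::euclidean_space set"
  assumes S: "S \<in> sets lebesgue" and \<delta>: "\<delta> > 0"
  shows "negligible {x \<in> S. \<forall>d>0. \<exists>e. 0 < e \<and> e < d \<and>
           \<delta> * measure lebesgue (ball x e) \<le> measure lebesgue (ball x e - S)}" (is "negligible ?A")
  unfolding negligible_outer
proof (intro allI impI)
  fix \<eta> :: real assume \<eta>: "\<eta> > 0"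
  have "\<delta> * \<eta> / 2 > 0" using \<delta> \<eta> by simp
  then obtain U where U: "open U" "S \<subseteq> U" "U - S \<in> lmeasurable"
      "emeasure lebesgue (U - S) < ennreal (\<delta> * \<eta> / 2)"
    using sets_lebesgue_outer_open[OF S] by metis
  define K where "K = {(x, r). x \<in> ?A \<and> 0 < r \<and> ball x r \<subseteq> U \<and>
      \<delta> * measure lebesgue (ball x r) \<le> measure lebesgue (ball x r - S)}"
  have K: "\<exists>i. i \<in> K \<and> x \<in> ball (fst i) (snd i) \<and> snd i < d" if x: "x \<in> ?A" and d: "0 < d" for x d
  proof -
    obtain d' where d': "d' > 0" "ball x d' \<subseteq> U"
      using openE[OF U(1), of x] U(2) x by blast
    obtain e where e: "0 < e" "e < min d d'"
        "\<delta> * measure lebesgue (ball x e) \<le> measure lebesgue (ball x e - S)"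
    proof -
      have "min d d' > 0" using d d'(1) by simp
      with x show thesis using that by blast
    qed
    have "ball x e \<subseteq> U"
      using d'(2) e(2) subset_ball[of e d' x] by auto
    then show ?thesis
      using x e d by (intro exI[of _ "(x, e)"]) (auto simp: K_def)
  qed
  obtain C where C: "countable C" "C \<subseteq> K"
      "pairwise (\<lambda>i j. disjnt (ball (fst i) (snd i)) (ball (fst j) (snd j))) C"
      "negligible (?A - (\<Union>i\<in>C. ball (fst i) (snd i)))"
    by (rule Vitali_covering_theorem_balls[of ?A K fst snd]) (use K in auto)
  let ?B = "\<lambda>i. ball (fst i) (snd i) :: 'a set"
  let ?V = "\<Union>i\<in>C. ?B i"
  have disj: "disjoint_family_on ?B C"
    using C(3) by (auto simp: disjoint_family_on_def pairwise_def disjnt_def)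
  then have disj': "disjoint_family_on (\<lambda>i. ?B i - S) C"
    unfolding disjoint_family_on_def by blast
  have "emeasure lebesgue ?V = (\<integral>\<^sup>+i. emeasure lebesgue (?B i) \<partial>count_space C)"
    by (rule emeasure_UN_countable) (use C(1) disj in auto)
  also have "\<dots> \<le> (\<integral>\<^sup>+i. ennreal (1 / \<delta>) * emeasure lebesgue (?B i - S) \<partial>count_space C)"
  proof (rule nn_integral_mono)
    fix i assume "i \<in> space (count_space C)"
    then have "i \<in> K" using C(2) by auto
    then have le: "measure lebesgue (?B i) \<le> 1 / \<delta> * measure lebesgue (?B i - S)"
      using \<delta> by (auto simp: K_def field_simps)
    have 1: "?B i \<in> lmeasurable" by simp
    then have 2: "?B i - S \<in> lmeasurable" using S by (rule fmeasurable_Diff)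
    have "emeasure lebesgue (?B i) = ennreal (measure lebesgue (?B i))"
      using 1 by (rule emeasure_eq_measure2)
    also have "\<dots> \<le> ennreal (1 / \<delta> * measure lebesgue (?B i - S))"
      using le by (rule ennreal_leI)
    also have "\<dots> = ennreal (1 / \<delta>) * emeasure lebesgue (?B i - S)"
      using \<delta> emeasure_eq_measure2[OF 2] by (simp add: ennreal_mult' del: times_divide_eq_left)
    finally show "emeasure lebesgue (?B i) \<le> ennreal (1 / \<delta>) * emeasure lebesgue (?B i - S)" .
  qed
  also have "\<dots> = ennreal (1 / \<delta>) * (\<integral>\<^sup>+i. emeasure lebesgue (?B i - S) \<partial>count_space C)"
    by (rule nn_integral_cmult) simp
  also have "\<dots> = ennreal (1 / \<delta>) * emeasure lebesgue (\<Union>i\<in>C. ?B i - S)"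
    by (subst emeasure_UN_countable) (use C(1) disj' S in auto)
  also have "\<dots> \<le> ennreal (1 / \<delta>) * ennreal (\<delta> * \<eta> / 2)"
  proof (rule mult_left_mono)
    have "?B i \<subseteq> U" if "i \<in> C" for i
    proof -
      have "i \<in> K" using C(2) that by blast
      then show ?thesis by (cases i) (simp add: K_def)
    qed
    then have "emeasure lebesgue (\<Union>i\<in>C. ?B i - S) \<le> emeasure lebesgue (U - S)"
      using U(3) by (intro emeasure_mono) (blast, simp add: fmeasurableD)
    then show "emeasure lebesgue (\<Union>i\<in>C. ?B i - S) \<le> ennreal (\<delta> * \<eta> / 2)"
      using U(4) by simp
  qed simp
  also have "\<dots> = ennreal (\<eta> / 2)"
    using \<delta> \<eta> by (simp flip: ennreal_mult)
  finally have V: "emeasure lebesgue ?V \<le> ennreal (\<eta> / 2)" .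
  have Vl: "?V \<in> lmeasurable"
    using V C(1) by (intro fmeasurableI) (auto intro: le_less_trans)
  have Vm: "measure lebesgue ?V \<le> \<eta> / 2"
    using V \<eta> emeasure_eq_measure2[OF Vl] by simp
  have neg: "?A - ?V \<in> lmeasurable" "measure lebesgue (?A - ?V) = 0"
    using C(4) by (auto simp: negligible_iff_measure)
  show "\<exists>T. ?A \<subseteq> T \<and> T \<in> lmeasurable \<and> measure lebesgue T < \<eta>"
  proof (intro exI conjI)
    show "?A \<subseteq> (?A - ?V) \<union> ?V" by blast
    show "(?A - ?V) \<union> ?V \<in> lmeasurable" using neg(1) Vl by (rule fmeasurable.Un)
    show "measure lebesgue ((?A - ?V) \<union> ?V) < \<eta>"
      using measure_Un_le[of "?A - ?V" lebesgue ?V] neg Vl Vm \<eta> by (auto simp: fmeasurableD)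
  qed
qed

lemma lebesgue_density:
  fixes S :: "'a::euclidean_space set"
  assumes S: "S \<in> sets lebesgue"
  shows "AE x in lebesgue. x \<in> S \<longrightarrow>
    ((\<lambda>e. measure lebesgue (ball x e - S) / measure lebesgue (ball x e)) \<longlongrightarrow> 0) (at_right 0)"
proof -
  let ?A = "\<lambda>n::nat. {x \<in> S. \<forall>d>0. \<exists>e. 0 < e \<and> e < d \<and>
           (1 / Suc n) * measure lebesgue (ball x e) \<le> measure lebesgue (ball x e - S)}"
  have "\<forall>n. AE x in lebesgue. x \<notin> ?A n"
  proof
    fix n
    have "negligible (?A n)" by (rule lebesgue_density_upper[OF S]) simp
    then show "AE x in lebesgue. x \<notin> ?A n"
      unfolding negligible_iff_null_sets by (rule AE_not_in)
  qed
  then have "AE x in lebesgue. \<forall>n. x \<notin> ?A n"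
    by (subst AE_all_countable)
  then show ?thesis
  proof eventually_elim
    fix x assume x: "\<forall>n. x \<notin> ?A n"
    show "x \<in> S \<longrightarrow> ((\<lambda>e. measure lebesgue (ball x e - S) / measure lebesgue (ball x e)) \<longlongrightarrow> 0) (at_right 0)"
    proof (intro impI tendstoI)
      fix \<eta> :: real assume "x \<in> S" and "0 < \<eta>"
      obtain n :: nat where n: "1 / Suc n < \<eta>"
        using \<open>0 < \<eta>\<close> nat_approx_posE by blast
      from x have "x \<notin> ?A n" ..
      then obtain d where d: "d > 0"
        "\<And>e. 0 < e \<Longrightarrow> e < d \<Longrightarrow> measure lebesgue (ball x e - S) < (1 / Suc n) * measure lebesgue (ball x e)"
        using \<open>x \<in> S\<close> unfolding mem_Collect_eq by (meson not_le)
      have "eventually (\<lambda>e::real. 0 < e \<and> e < d) (at_right 0)"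
        using d(1) by (auto simp: eventually_at_right_field)
      then show "eventually (\<lambda>e. dist (measure lebesgue (ball x e - S) / measure lebesgue (ball x e)) 0 < \<eta>) (at_right 0)"
      proof eventually_elim
        case (elim e)
        have pos: "measure lebesgue (ball x e) > 0"
          using content_ball_pos[of e x] elim by simp
        have "measure lebesgue (ball x e - S) / measure lebesgue (ball x e) < 1 / Suc n"
          using d(2)[of e] elim pos by (simp add: field_simps)
        then show ?case using n by simp
      qed
    qed
  qed
qed

section \<open>The evaluation functional on bounded functions\<close>
lemma integrable_indicator_fmeasurable:
  assumes "A \<in> fmeasurable M"
  shows "integrable M (indicator A :: _ \<Rightarrow> real)"
  using assms by (intro integrable_real_indicator) (auto simp: fmeasurable_def)

lemma set_lebesgue_integral_ball_eq:
  fixes X :: "'a::euclidean_space set" and f :: "'a \<Rightarrow> real"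
  assumes X: "X \<in> sets lebesgue"
  shows "(LINT y:ball x e \<inter> X|lebesgue. f y) = (\<integral>y. f y * indicator (ball x e) y \<partial>lebesgue_on X)"
proof -
  have "(\<integral>y. f y * indicator (ball x e) y \<partial>lebesgue_on X)
      = (\<integral>y. indicator X y *\<^sub>R (f y * indicator (ball x e) y) \<partial>lebesgue)"
    using X by (intro integral_restrict_space) auto
  also have "\<dots> = (LINT y:ball x e \<inter> X|lebesgue. f y)"
    unfolding set_lebesgue_integral_def by (intro Bochner_Integration.integral_cong) (auto simp: indicator_def)
  finally show ?thesis by simp
qed

lemma integrable_indicator_ball:
  fixes X :: "'a::euclidean_space set"
  assumes X: "X \<in> sets lebesgue"
  shows "integrable (lebesgue_on X) (indicator (ball x e) :: 'a \<Rightarrow> real)"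
proof -
  have "integrable lebesgue (indicator (X \<inter> ball x e) :: 'a \<Rightarrow> real)"
    using X fmeasurable_Int_fmeasurable[of "ball x e" lebesgue X]
    by (intro integrable_indicator_fmeasurable) (simp add: Int_commute)
  then show ?thesis
    using X by (simp add: integrable_restrict_space flip: indicator_inter_arith)
qed

lemma integrable_bounded_mult_ball:
  fixes X :: "'a::euclidean_space set" and f :: "'a \<Rightarrow> real"
  assumes X: "X \<in> sets lebesgue" and f: "f \<in> borel_measurable (lebesgue_on X)"
    and B: "\<And>y. \<bar>f y\<bar> \<le> B"
  shows "integrable (lebesgue_on X) (\<lambda>y. f y * indicator (ball x e) y)"
proof (rule Bochner_Integration.integrable_bound)
  show "integrable (lebesgue_on X) (\<lambda>y. B * indicator (ball x e) y)"
    using integrable_indicator_ball[OF X] by simp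
  show "(\<lambda>y. f y * indicator (ball x e) y) \<in> borel_measurable (lebesgue_on X)"
    using f borel_measurable_integrable[OF integrable_indicator_ball[OF X]] by simp
  have "\<bar>f y\<bar> \<le> \<bar>B\<bar>" for y using B[of y] by simp
  then show "AE y in lebesgue_on X. norm (f y * indicator (ball x e) y) \<le> norm (B * indicator (ball x e) y)"
    by (auto simp: indicator_def)
qed

lemma average_bounds:
  fixes X :: "'a::euclidean_space set" and x :: 'a and e B :: real
  assumes X: "X \<in> sets lebesgue" and f: "f \<in> borel_measurable (lebesgue_on X)"
    and B: "\<And>y. 0 \<le> f y" "\<And>y. f y \<le> B" and e: "e > 0"
  defines "A \<equiv> 1 / measure lebesgue (ball x e) * (LINT y:ball x e \<inter> X|lebesgue. f y)"
  shows "0 \<le> A" and "A \<le> B"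
proof -
  have B0: "0 \<le> B" using B(1)[of x] B(2)[of x] by simp
  show "0 \<le> A"
    unfolding A_def set_lebesgue_integral_ball_eq[OF X] using B(1) by simp
  have "(\<integral>y. f y * indicator (ball x e) y \<partial>lebesgue_on X) \<le> (\<integral>y. B * indicator (ball x e) y \<partial>lebesgue_on X)"
  proof (rule integral_mono)
    show "integrable (lebesgue_on X) (\<lambda>y. f y * indicator (ball x e) y)"
      using B by (intro integrable_bounded_mult_ball[OF X f, of B]) simp
    show "integrable (lebesgue_on X) (\<lambda>y. B * indicator (ball x e) y)"
      using integrable_indicator_ball[OF X] by simp
  qed (use B in \<open>auto simp: indicator_def\<close>)
  also have "\<dots> = B * measure lebesgue (X \<inter> ball x e)"
    using X by (simp add: integral_restrict_space indicator_inter_arith[symmetric] measure_restrict_space Int_commute)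
  also have "\<dots> \<le> B * measure lebesgue (ball x e)"
    using X B0 by (intro mult_left_mono measure_mono_fmeasurable) auto
  finally show "A \<le> B"
    unfolding A_def set_lebesgue_integral_ball_eq[OF X]
    using content_ball_pos[OF e, of x] by (simp add: field_simps)
qed

lemma eval_fun_mono:
  fixes X :: "'a::euclidean_space set"
  assumes X: "X \<in> sets lebesgue"
    and f: "f \<in> borel_measurable (lebesgue_on X)" and g: "g \<in> borel_measurable (lebesgue_on X)"
    and le: "\<And>y. 0 \<le> f y" "\<And>y. f y \<le> g y" "\<And>y. g y \<le> B"
  shows "eval_fun X x f \<le> eval_fun X x g"
proof -
  let ?A = "\<lambda>f e. ereal (1 / measure lebesgue (ball x e) * (LINT y:ball x e \<inter> X|lebesgue. f y))"
  let ?L = "\<lambda>f. Limsup (at_right 0) (?A f)"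
  have g0: "\<And>y. 0 \<le> g y" and fB: "\<And>y. f y \<le> B"
    using le order_trans by blast+
  have pos: "eventually (\<lambda>e::real. e > 0) (at_right 0)"
    by (simp add: eventually_at_right_less)
  have "eventually (\<lambda>e. 0 \<le> ?A f e) (at_right 0)"
    using pos by eventually_elim (use average_bounds(1)[OF X f le(1) fB] in auto)
  then have "0 \<le> ?L f"
    by (intro le_Limsup) auto
  moreover have "eventually (\<lambda>e. ?A g e \<le> ereal B) (at_right 0)"
    using pos by eventually_elim (use average_bounds(2)[OF X g g0 le(3)] in auto)
  then have "?L g \<le> ereal B"
    by (rule Limsup_bounded)
  moreover have "?L f \<le> ?L g"
  proof (intro Limsup_mono always_eventually allI)
    fix e
    have "(LINT y:ball x e \<inter> X|lebesgue. f y) \<le> (LINT y:ball x e \<inter> X|lebesgue. g y)"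
      unfolding set_lebesgue_integral_ball_eq[OF X]
    proof (rule integral_mono)
      show "integrable (lebesgue_on X) (\<lambda>y. f y * indicator (ball x e) y)"
        using le(1) fB by (intro integrable_bounded_mult_ball[OF X f, of B]) simp
      show "integrable (lebesgue_on X) (\<lambda>y. g y * indicator (ball x e) y)"
        using g0 le(3) by (intro integrable_bounded_mult_ball[OF X g, of B]) simp
    qed (use le in \<open>auto simp: indicator_def\<close>)
    then show "?A f e \<le> ?A g e"
      by (simp add: divide_right_mono)
  qed
  ultimately show ?thesis
    unfolding eval_fun_def by (intro real_of_ereal_positive_mono) auto
qed

text \<open>For functions with two values the Lebesgue differentiation theorem is the density theorem,
  applied to the set where one value is taken and to its complement in \<open>X\<close>.\<close>

lemma AE_eval_fun_two_valued:
  fixes X :: "'a::euclidean_space set"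
  assumes X: "open X" and S: "S \<in> sets lebesgue" "S \<subseteq> X"
  shows "AE x in lebesgue_on X. eval_fun X x (\<lambda>y. a + c * indicator S y) = a + c * indicator S x"
proof -
  have Xl: "X \<in> sets lebesgue" using X by auto
  have "X - S \<in> sets lebesgue" using Xl S by auto
  note dens = lebesgue_density[OF S(1)] lebesgue_density[OF this]
  have "AE x in lebesgue. x \<in> X \<longrightarrow> eval_fun X x (\<lambda>y. a + c * indicator S y) = a + c * indicator S x"
    using dens
  proof eventually_elim
    fix x
    let ?m = "measure lebesgue"
    assume 1: "x \<in> S \<longrightarrow> ((\<lambda>e. ?m (ball x e - S) / ?m (ball x e)) \<longlongrightarrow> 0) (at_right 0)"
      and 2: "x \<in> X - S \<longrightarrow> ((\<lambda>e. ?m (ball x e - (X - S)) / ?m (ball x e)) \<longlongrightarrow> 0) (at_right 0)"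
    show "x \<in> X \<longrightarrow> eval_fun X x (\<lambda>y. a + c * indicator S y) = a + c * indicator S x"
    proof
      assume xX: "x \<in> X"
      then obtain d where d: "d > 0" "ball x d \<subseteq> X" using X openE by blast
      have ev: "eventually (\<lambda>e::real. 0 < e \<and> e < d) (at_right 0)"
        using d(1) by (auto simp: eventually_at_right_field)
      have sub: "ball x e \<subseteq> X" if "e < d" for e
        using d(2) subset_ball[of e d x] that by auto
      have avg: "1 / ?m (ball x e) * (LINT y:ball x e \<inter> X|lebesgue. a + c * indicator S y)
          = a + c * (?m (ball x e \<inter> S) / ?m (ball x e))" if e: "0 < e \<and> e < d" for e
      proof -
        have pos: "?m (ball x e) > 0" using content_ball_pos[of e x] e by simp
        have bS: "ball x e \<inter> S \<in> lmeasurable"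
          using S by (intro fmeasurable_Int_fmeasurable) auto
        have "(LINT y:ball x e \<inter> X|lebesgue. a + c * indicator S y)
            = (\<integral>y. a * indicator (ball x e) y + c * indicator (ball x e \<inter> S) y \<partial>lebesgue)"
          unfolding set_lebesgue_integral_def using sub[of e] e
          by (intro Bochner_Integration.integral_cong) (auto simp: indicator_def)
        also have "\<dots> = a * ?m (ball x e) + c * ?m (ball x e \<inter> S)"
          using integrable_indicator_fmeasurable[OF bS]
            integrable_indicator_fmeasurable[of "ball x e" lebesgue]
          by (subst Bochner_Integration.integral_add) auto
        finally show ?thesis using pos by (simp add: field_simps)
      qed
      have "((\<lambda>e. ?m (ball x e \<inter> S) / ?m (ball x e)) \<longlongrightarrow> indicator S x) (at_right 0)"
      proof (cases "x \<in> S")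
        case True
        have "eventually (\<lambda>e. 1 - ?m (ball x e - S) / ?m (ball x e) = ?m (ball x e \<inter> S) / ?m (ball x e)) (at_right 0)"
          using ev
        proof eventually_elim
          case (elim e)
          have pos: "?m (ball x e) > 0" using content_ball_pos[of e x] elim by simp
          have "?m (ball x e - S) = ?m (ball x e) - ?m (ball x e \<inter> S)"
            using S measurable_measure_Diff[of "ball x e" lebesgue "ball x e \<inter> S"]
            by (simp add: Diff_Int sets.Int)
          then show ?case using pos by (simp add: field_simps)
        qed
        moreover have "((\<lambda>e. 1 - ?m (ball x e - S) / ?m (ball x e)) \<longlongrightarrow> 1 - 0) (at_right 0)"
          using 1 True by (intro tendsto_diff tendsto_const) auto
        ultimately show ?thesis using True Lim_transform_eventually by fastforce
      next
        case False
        have "eventually (\<lambda>e. ?m (ball x e - (X - S)) / ?m (ball x e) = ?m (ball x e \<inter> S) / ?m (ball x e)) (at_right 0)"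
          using ev
        proof eventually_elim
          case (elim e)
          have "ball x e - (X - S) = ball x e \<inter> S" using sub[of e] elim by auto
          then show ?case by simp
        qed
        from Lim_transform_eventually[OF _ this] show ?thesis using 2 xX False by simp
      qed
      then have "((\<lambda>e. a + c * (?m (ball x e \<inter> S) / ?m (ball x e))) \<longlongrightarrow> a + c * indicator S x) (at_right 0)"
        by (intro tendsto_intros)
      moreover have "eventually (\<lambda>e. 1 / ?m (ball x e) * (LINT y:ball x e \<inter> X|lebesgue. a + c * indicator S y)
          = a + c * (?m (ball x e \<inter> S) / ?m (ball x e))) (at_right 0)"
        using ev by eventually_elim (rule avg)
      ultimately have "((\<lambda>e. 1 / ?m (ball x e) * (LINT y:ball x e \<inter> X|lebesgue. a + c * indicator S y))
          \<longlongrightarrow> a + c * indicator S x) (at_right 0)"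
        by (subst tendsto_cong)
      then have "Limsup (at_right 0) (\<lambda>e. ereal (1 / ?m (ball x e) * (LINT y:ball x e \<inter> X|lebesgue. a + c * indicator S y)))
          = ereal (a + c * indicator S x)"
        by (intro lim_imp_Limsup tendsto_ereal) auto
      then show "eval_fun X x (\<lambda>y. a + c * indicator S y) = a + c * indicator S x"
        by (simp add: eval_fun_def)
    qed
  qed
  then show ?thesis using Xl by (simp add: AE_restrict_space_iff)
qed

section \<open>Borel structure and topology of the space of extreme points\<close>
lemma sets_borel_of: "sets (borel_of T) = sigma_sets (topspace T) {U. openin T U}"
  unfolding borel_of_def by (rule sets_measure_of) (auto dest: openin_subset)

lemma space_borel_of: "space (borel_of T) = topspace T"
  unfolding borel_of_def by (rule space_measure_of) (auto dest: openin_subset)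

lemma openin_imp_sets_borel_of: "openin T U \<Longrightarrow> U \<in> sets (borel_of T)"
  by (simp add: sets_borel_of sigma_sets.Basic)

lemma closedin_imp_sets_borel_of: "closedin T K \<Longrightarrow> K \<in> sets (borel_of T)"
  using openin_imp_sets_borel_of[of T "topspace T - K"] sets.compl_sets[of "topspace T - K" "borel_of T"]
  by (simp add: closedin_def space_borel_of double_diff)

lemma measurable_borel_of:
  assumes "f \<in> space M \<rightarrow> topspace T" and "\<And>U. openin T U \<Longrightarrow> f -` U \<inter> space M \<in> sets M"
  shows "f \<in> measurable M (borel_of T)"
  unfolding borel_of_def by (rule measurable_measure_of) (use assms in \<open>auto dest: openin_subset\<close>)

lemma Linfty_rep:
  assumes "r \<in> Linfty X"
  shows "rep r \<in> borel_measurable (lebesgue_on X)" and "\<exists>B. AE x in lebesgue_on X. \<bar>rep r x\<bar> \<le> B"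
    and "r = ae_class X (rep r)"
proof -
  obtain f B where f: "r = ae_class X f" "f \<in> borel_measurable (lebesgue_on X)"
      "AE x in lebesgue_on X. \<bar>f x\<bar> \<le> B"
    using assms by (auto simp: Linfty_def)
  show m: "rep r \<in> borel_measurable (lebesgue_on X)"
    using rep_ae_class(1)[OF f(2)] f(1) by simp
  have eq: "AE x in lebesgue_on X. rep r x = f x"
    using rep_ae_class(2)[OF f(2)] f(1) by simp
  show "\<exists>B. AE x in lebesgue_on X. \<bar>rep r x\<bar> \<le> B"
    using eq f(3) by (intro exI[of _ B], eventually_elim) simp
  show "r = ae_class X (rep r)"
    using ae_class_eq_iff[OF m f(2)] eq f(1) by simp
qed

lemma integrable_rep_mult:
  assumes r: "r \<in> Linfty X" and g: "integrable (lebesgue_on X) g"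
  shows "integrable (lebesgue_on X) (\<lambda>x. rep r x * g x)"
proof -
  obtain B where B: "AE x in lebesgue_on X. \<bar>rep r x\<bar> \<le> B" using Linfty_rep(2)[OF r] by blast
  show ?thesis
  proof (rule Bochner_Integration.integrable_bound)
    show "integrable (lebesgue_on X) (\<lambda>x. B * g x)" using g by simp
    show "(\<lambda>x. rep r x * g x) \<in> borel_measurable (lebesgue_on X)"
      using Linfty_rep(1)[OF r] borel_measurable_integrable[OF g] by simp
    show "AE x in lebesgue_on X. norm (rep r x * g x) \<le> norm (B * g x)"
      using B by eventually_elim (simp add: abs_mult mult_right_mono)
  qed
qed

lemma continuous_map_pairing:
  assumes g: "integrable (lebesgue_on X) g"
  shows "continuous_map (weak_star X) euclideanreal (pairing X g)"
  unfolding continuous_map_def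
proof (intro conjI allI impI)
  fix U :: "real set" assume "openin euclideanreal U"
  then have "{r \<in> Linfty X. pairing X g r \<in> U} \<in>
      {{r \<in> Linfty X. pairing X g r \<in> U} | g U. integrable (lebesgue_on X) g \<and> open U}"
    using g by auto
  from topology_generated_by_Basis[OF this]
  show "openin (weak_star X) {r \<in> topspace (weak_star X). pairing X g r \<in> U}"
    by (simp add: topspace_weak_star flip: weak_star_def)
qed simp

text \<open>Two classes with the same pairings agree almost everywhere on every ball: pair them with the
  sign of their difference, cut off to the ball.\<close>

lemma Hausdorff_weak_star:
  fixes X :: "'a::euclidean_space set"
  assumes X: "X \<in> sets lebesgue"
  shows "Hausdorff_space (weak_star X)"
  unfolding Hausdorff_space_def topspace_weak_star
proof (intro allI impI, elim conjE)
  fix r s assume rs: "r \<in> Linfty X" "s \<in> Linfty X" "r \<noteq> s"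
  note m = Linfty_rep(1)[OF rs(1)] Linfty_rep(1)[OF rs(2)]
  have "\<exists>g. integrable (lebesgue_on X) g \<and> pairing X g r \<noteq> pairing X g s"
  proof (rule ccontr)
    assume "\<not> ?thesis"
    then have same: "pairing X g r = pairing X g s" if "integrable (lebesgue_on X) g" for g
      using that by blast
    have "AE x in lebesgue_on X. \<bar>rep r x - rep s x\<bar> * indicator (ball 0 (real n)) x = 0" for n
    proof -
      let ?w = "indicator (ball 0 (real n)) :: 'a \<Rightarrow> real"
      note w = integrable_indicator_ball[OF X, of 0 "real n"]
      define g where "g = (\<lambda>x. sgn (rep r x - rep s x) * ?w x)"
      have gm: "g \<in> borel_measurable (lebesgue_on X)"
        unfolding g_def using m borel_measurable_integrable[OF w] by measurable
      have g: "integrable (lebesgue_on X) g"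
        by (rule Bochner_Integration.integrable_bound[OF w gm])
          (auto simp: g_def abs_mult sgn_if)
      have "rep r x * g x - rep s x * g x = \<bar>rep r x - rep s x\<bar> * ?w x" for x
        by (simp add: g_def sgn_if algebra_simps)
      moreover have "integrable (lebesgue_on X) (\<lambda>x. rep r x * g x - rep s x * g x)"
        "(\<integral>x. rep r x * g x - rep s x * g x \<partial>lebesgue_on X) = 0"
        using integrable_rep_mult[OF rs(1) g] integrable_rep_mult[OF rs(2) g] same[OF g]
        by (simp_all add: pairing_def)
      ultimately show ?thesis
        by (subst integral_nonneg_eq_0_iff_AE[symmetric]) auto
    qed
    then have "AE x in lebesgue_on X. \<forall>n. \<bar>rep r x - rep s x\<bar> * indicator (ball 0 (real n)) x = 0"
      by (subst AE_all_countable) blast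
    then have "AE x in lebesgue_on X. rep r x = rep s x"
    proof eventually_elim
      fix x assume *: "\<forall>n. \<bar>rep r x - rep s x\<bar> * indicator (ball 0 (real n)) x = 0"
      obtain n where "norm x < real n" using reals_Archimedean2 by blast
      with * show "rep r x = rep s x" by (auto dest: spec[of _ n])
    qed
    then show False
      using ae_class_eq_iff[OF m] Linfty_rep(3)[OF rs(1)] Linfty_rep(3)[OF rs(2)] rs(3) by simp
  qed
  then obtain g where g: "integrable (lebesgue_on X) g" "pairing X g r \<noteq> pairing X g s" by blast
  then obtain U V where UV: "open U" "open V" "pairing X g r \<in> U" "pairing X g s \<in> V" "U \<inter> V = {}"
    using hausdorff[OF g(2)] by blast
  let ?P = "\<lambda>U. {r \<in> topspace (weak_star X). pairing X g r \<in> U}"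
  have "openin (weak_star X) (?P U)" "openin (weak_star X) (?P V)"
    using continuous_map_pairing[OF g(1)] UV(1,2) by (auto simp: continuous_map_def)
  then show "\<exists>U V. openin (weak_star X) U \<and> openin (weak_star X) V \<and> r \<in> U \<and> s \<in> V \<and> disjnt U V"
    using UV rs by (intro exI[of _ "?P U"] exI[of _ "?P V"]) (auto simp: disjnt_def topspace_weak_star)
qed

lemma Hausdorff_E_top:
  fixes X :: "'a::euclidean_space set"
  shows "X \<in> sets lebesgue \<Longrightarrow> Hausdorff_space (E_top \<alpha> X)"
  unfolding E_top_def C_top_def by (intro Hausdorff_space_subtopology Hausdorff_weak_star)

lemma continuous_map_pairing_E_top:
  "integrable (lebesgue_on X) g \<Longrightarrow> continuous_map (E_top \<alpha> X) euclideanreal (pairing X g)"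
  unfolding E_top_def C_top_def
  by (intro continuous_map_from_subtopology continuous_map_pairing)

lemma continuous_map_into_E_top:
  fixes X :: "'a::euclidean_space set"
  assumes \<alpha>: "\<alpha> \<ge> 0" and T: "\<And>y. y \<in> topspace Y \<Longrightarrow> T y \<in> E_set \<alpha> X"
    and cont: "\<And>g. integrable (lebesgue_on X) g \<Longrightarrow> continuous_map Y euclideanreal (\<lambda>y. pairing X g (T y))"
  shows "continuous_map Y (E_top \<alpha> X) T"
proof -
  note sub = E_set_subset_C_set[OF \<alpha>, of X] C_set_subset_Linfty[of \<alpha> X]
  have "continuous_map Y (weak_star X) T"
    unfolding weak_star_def
  proof (rule continuous_on_generated_topo)
    fix U assume "U \<in> {{r \<in> Linfty X. pairing X g r \<in> U} | g U. integrable (lebesgue_on X) g \<and> open U}"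
    then obtain g V where gV: "U = {r \<in> Linfty X. pairing X g r \<in> V}" "integrable (lebesgue_on X) g" "open V"
      by blast
    then have "openin Y {y \<in> topspace Y. pairing X g (T y) \<in> V}"
      using cont[OF gV(2)] by (auto simp: continuous_map_def)
    moreover have "{y \<in> topspace Y. pairing X g (T y) \<in> V} = T -` U \<inter> topspace Y"
      using T sub by (auto simp: gV(1))
    ultimately show "openin Y (T -` U \<inter> topspace Y)" by simp
  next
    have "\<Union>{{r \<in> Linfty X. pairing X g r \<in> U} | g U. integrable (lebesgue_on X) g \<and> open U} = Linfty X"
      using topspace_weak_star[of X] by (simp add: weak_star_def topology_generated_by_topspace)
    then show "T ` topspace Y \<subseteq> \<Union>{{r \<in> Linfty X. pairing X g r \<in> U} | g U. integrable (lebesgue_on X) g \<and> open U}"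
      using T sub by blast
  qed
  then show ?thesis
    unfolding E_top_def C_top_def using T sub
    by (auto simp: continuous_map_in_subtopology)
qed

text \<open>
  The averages over a fixed ball are continuous functionals, so an uncountable supremum of them is
  lower semicontinuous and hence Borel. The limit superior at \<open>0\<close> is then a countable infimum.
\<close>

lemma borel_measurable_eval_at:
  fixes X :: "'a::euclidean_space set"
  assumes X: "X \<in> sets lebesgue"
  shows "(\<lambda>r. eval_at X x r) \<in> borel_measurable (borel_of (E_top \<alpha> X))"
proof -
  let ?M = "borel_of (E_top \<alpha> X)"
  define F where "F = (\<lambda>e r. ereal (1 / measure lebesgue (ball x e) * pairing X (indicator (ball x e)) r))"
  have F: "ereal (1 / measure lebesgue (ball x e) * (LINT y:ball x e \<inter> X|lebesgue. rep r y)) = F e r" for e r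
    by (simp add: F_def pairing_def set_lebesgue_integral_ball_eq[OF X])
  have openF: "openin (E_top \<alpha> X) {r \<in> topspace (E_top \<alpha> X). a < F e r}" for e a
  proof -
    have "continuous_map (E_top \<alpha> X) euclideanreal
        (\<lambda>r. 1 / measure lebesgue (ball x e) * pairing X (indicator (ball x e)) r)"
      by (intro continuous_intros continuous_map_pairing_E_top integrable_indicator_ball[OF X])
    moreover have "open {y. a < ereal y}"
      by (rule open_ereal_vimage[of "{a<..}", unfolded vimage_def greaterThan_iff]) simp
    ultimately have "openin (E_top \<alpha> X) {r \<in> topspace (E_top \<alpha> X).
        (1 / measure lebesgue (ball x e) * pairing X (indicator (ball x e)) r) \<in> {y. a < ereal y}}"
      by (intro openin_continuous_map_preimage) auto
    then show ?thesis by (simp add: F_def)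
  qed
  define G where "G = (\<lambda>d r. SUP e\<in>{0<..<d}. F e r)"
  have Gm: "G d \<in> borel_measurable ?M" for d
  proof (rule borel_measurableI_greater)
    fix a
    have "{r \<in> space ?M. a < G d r} = (\<Union>e\<in>{0<..<d}. {r \<in> topspace (E_top \<alpha> X). a < F e r})"
      by (auto simp: G_def less_SUP_iff space_borel_of)
    then show "{r \<in> space ?M. a < G d r} \<in> sets ?M"
      using openF by (auto intro!: openin_imp_sets_borel_of)
  qed
  have "Limsup (at_right 0) (\<lambda>e. F e r) = (INF n. G (1 / real (Suc n)) r)" for r
  proof -
    have "Limsup (at_right 0) (\<lambda>e. F e r) = (INF d\<in>{0<..}. G d r)"
      unfolding Limsup_within G_def
      by (intro INF_cong SUP_cong) (auto simp: dist_real_def)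
    also have "\<dots> = (INF n. G (1 / real (Suc n)) r)"
    proof (rule INF_eq)
      fix d :: real assume "d \<in> {0<..}"
      then obtain n :: nat where "1 / real (Suc n) < d" using nat_approx_posE by auto
      then have "G (1 / real (Suc n)) r \<le> G d r"
        unfolding G_def by (intro SUP_subset_mono) auto
      then show "\<exists>n\<in>UNIV. G (1 / real (Suc n)) r \<le> G d r" by blast
    qed (auto intro!: bexI[of _ "1 / real (Suc _)"])
    finally show ?thesis .
  qed
  then have "eval_at X x r = real_of_ereal (INF n. G (1 / real (Suc n)) r)" for r
    unfolding eval_at_def eval_fun_def F by simp
  then show ?thesis
    using Gm by simp
qed

section \<open>Images of measures and conditional distributions\<close>
lemma measurable_borel_of_continuous_off_countable:
  fixes T :: "'b::{second_countable_topology, t1_space} \<Rightarrow> 'c"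
  assumes D: "countable D" and T: "\<And>y. T y \<in> topspace E"
    and cont: "continuous_map (top_of_set (- D)) E T"
  shows "T \<in> borel \<rightarrow>\<^sub>M borel_of E"
proof (rule measurable_borel_of)
  fix U assume "openin E U"
  then have "openin (top_of_set (- D)) {y \<in> topspace (top_of_set (- D)). T y \<in> U}"
    using cont by (intro openin_continuous_map_preimage)
  then obtain W where W: "open W" "{y \<in> topspace (top_of_set (- D)). T y \<in> U} = - D \<inter> W"
    by (auto simp: openin_open)
  have ctbl: "countable (T -` U \<inter> D)" using D by auto
  have "D \<in> sets borel" "T -` U \<inter> D \<in> sets borel"
    using D ctbl by (auto intro: sets.countable)
  then have "(- D \<inter> W) \<union> (T -` U \<inter> D) \<in> sets borel"
    using W(1) by (auto intro!: sets.Un sets.Int)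
  also have "(- D \<inter> W) \<union> (T -` U \<inter> D) = T -` U \<inter> space borel"
    using W(2)[symmetric] by auto
  finally show "T -` U \<inter> space borel \<in> sets borel" .
qed (use T in auto)

text \<open>
  Only compact sets that avoid the discontinuities are pushed forward: their images are compact,
  and they still exhaust the mass. The Hausdorff property makes these images measurable.
\<close>

lemma radon_measure_distr:
  fixes N :: "'b::{second_countable_topology, complete_space} measure"
  assumes N: "sets N = sets borel" "finite_measure N"
    and D: "countable D" "emeasure N D = 0" and T: "\<And>y. T y \<in> topspace E"
    and cont: "continuous_map (top_of_set (- D)) E T" and E: "Hausdorff_space E"
  shows "radon_measure E (distr N (borel_of E) T)"
proof -
  interpret finite_measure N by (rule N(2))
  let ?\<mu> = "distr N (borel_of E) T"
  have spN: "space N = UNIV" using sets_eq_imp_space_eq[OF N(1)] by simp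
  have Tm: "T \<in> N \<rightarrow>\<^sub>M borel_of E"
    using measurable_borel_of_continuous_off_countable[OF D(1) T cont]
    by (simp add: measurable_cong_sets[OF N(1) refl])
  interpret \<mu>: finite_measure ?\<mu> by (rule finite_measure_distr[OF Tm])
  have Dm: "D \<in> sets N" using D(1) by (auto simp: N(1) intro: sets.countable)
  show ?thesis
    unfolding radon_measure_def
  proof (intro conjI ballI)
    fix x assume "x \<in> topspace E"
    then show "\<exists>U. openin E U \<and> x \<in> U \<and> emeasure ?\<mu> U < \<infinity>"
      by (intro exI[of _ "topspace E"]) (simp add: less_top[symmetric])
  next
    fix A assume A: "A \<in> sets ?\<mu>"
    let ?B = "T -` A - D"
    have TA: "T -` A \<in> sets N" using measurable_sets[OF Tm, of A] A spN by simp
    show "emeasure ?\<mu> A = (SUP K\<in>{K. compactin E K \<and> K \<subseteq> A}. emeasure ?\<mu> K)"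
    proof (rule antisym)
      have "emeasure ?\<mu> A = emeasure N (T -` A)"
        using A spN by (subst emeasure_distr[OF Tm]) auto
      also have "\<dots> = emeasure N ?B"
        using TA Dm D(2) by (intro emeasure_Diff_null_set[symmetric]) auto
      also have "\<dots> = (SUP K\<in>{K. K \<subseteq> ?B \<and> compact K}. emeasure N K)"
        using TA Dm by (intro inner_regular N(1)) (auto simp: N(1)[symmetric])
      also have "\<dots> \<le> (SUP K\<in>{K. compactin E K \<and> K \<subseteq> A}. emeasure ?\<mu> K)"
      proof (rule SUP_mono)
        fix K assume K: "K \<in> {K. K \<subseteq> ?B \<and> compact K}"
        then have "compactin (top_of_set (- D)) K"
          by (auto simp: compactin_subtopology)
        then have TK: "compactin E (T ` K)"
          using cont by (rule image_compactin)
        then have "T ` K \<in> sets (borel_of E)"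
          using E by (intro closedin_imp_sets_borel_of compactin_imp_closedin)
        then have "emeasure ?\<mu> (T ` K) = emeasure N (T -` (T ` K))"
          using spN by (subst emeasure_distr[OF Tm]) auto
        moreover have "T -` (T ` K) \<in> sets N"
          using measurable_sets[OF Tm \<open>T ` K \<in> sets (borel_of E)\<close>] spN by simp
        ultimately have "emeasure N K \<le> emeasure ?\<mu> (T ` K)"
          by (simp add: emeasure_mono subset_vimage_iff)
        then show "\<exists>L\<in>{K. compactin E K \<and> K \<subseteq> A}. emeasure N K \<le> emeasure ?\<mu> L"
          using TK K by (intro bexI[of _ "T ` K"]) auto
      qed
      finally show "emeasure ?\<mu> A \<le> (SUP K\<in>{K. compactin E K \<and> K \<subseteq> A}. emeasure ?\<mu> K)" .
      show "(SUP K\<in>{K. compactin E K \<and> K \<subseteq> A}. emeasure ?\<mu> K) \<le> emeasure ?\<mu> A"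
        using A by (intro SUP_least emeasure_mono) auto
    qed
  qed simp
qed

text \<open>
  The kernel \<open>k\<close> is the conditional distribution of the discrete variable \<open>Z\<close> given \<open>T\<close>. Its
  probabilities are the Radon-Nikodym derivatives of the images of \<open>P\<close> restricted to
  \<open>Z = z\<close>, which add up to \<open>1\<close> almost everywhere.
\<close>

lemma conditional_pmf_exists:
  fixes P :: "'w measure" and Z :: "'w \<Rightarrow> 'z::countable" and T :: "'w \<Rightarrow> 'e"
  assumes P: "finite_measure P" and Z: "Z \<in> P \<rightarrow>\<^sub>M count_space UNIV" and T: "T \<in> P \<rightarrow>\<^sub>M E"
  obtains k :: "'e \<Rightarrow> 'z pmf" where "\<And>z. (\<lambda>r. pmf (k r) z) \<in> borel_measurable E"
    and "\<And>z g. g \<in> borel_measurable E \<Longrightarrow>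
      (\<integral>\<^sup>+r. g r * ennreal (pmf (k r) z) \<partial>distr P E T) = (\<integral>\<^sup>+w. g (T w) * indicator {z} (Z w) \<partial>P)"
proof -
  interpret P: finite_measure P by (rule P)
  let ?\<mu> = "distr P E T"
  interpret \<mu>: finite_measure ?\<mu> by (rule P.finite_measure_distr[OF T])
  have ind[measurable]: "(\<lambda>w. indicator {z} (Z w) :: ennreal) \<in> borel_measurable P" for z
    using Z by measurable
  note T[measurable]
  define \<nu> where "\<nu> z = distr (density P (\<lambda>w. indicator {z} (Z w))) E T" for z
  have T': "T \<in> density P h \<rightarrow>\<^sub>M E" for h using T by simp
  have \<nu>: "(\<integral>\<^sup>+r. g r \<partial>\<nu> z) = (\<integral>\<^sup>+w. g (T w) * indicator {z} (Z w) \<partial>P)"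
    if [measurable]: "g \<in> borel_measurable E" for g z
    unfolding \<nu>_def by (subst nn_integral_distr[OF T'], simp, subst nn_integral_density) (auto simp: mult.commute)
  have \<nu>A: "emeasure (\<nu> z) A = (\<integral>\<^sup>+w. indicator A (T w) * indicator {z} (Z w) \<partial>P)" if "A \<in> sets E" for A z
    using \<nu>[of "indicator A" z] that by (simp add: \<nu>_def)
  define f where "f z = RN_deriv ?\<mu> (\<nu> z)" for z
  have fm[measurable]: "f z \<in> borel_measurable E" for z
    using borel_measurable_RN_deriv[of ?\<mu> "\<nu> z"] by (simp add: f_def)
  have dens: "density ?\<mu> (f z) = \<nu> z" for z
    unfolding f_def
  proof (rule \<mu>.density_RN_deriv)
    show "absolutely_continuous ?\<mu> (\<nu> z)"
      unfolding absolutely_continuous_def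
    proof
      fix A assume "A \<in> null_sets ?\<mu>"
      then have A: "A \<in> sets E" "emeasure ?\<mu> A = 0" by auto
      have "emeasure (\<nu> z) A \<le> (\<integral>\<^sup>+w. indicator A (T w) \<partial>P)"
        unfolding \<nu>A[OF A(1)] by (intro nn_integral_mono) (auto simp: indicator_def)
      also have "\<dots> = emeasure ?\<mu> A"
        using A(1) nn_integral_distr[OF T, of "indicator A"] by simp
      finally show "A \<in> null_sets (\<nu> z)" using A by (auto simp: \<nu>_def)
    qed
  qed (simp add: \<nu>_def)
  define F where "F r = (\<integral>\<^sup>+z. f z r \<partial>count_space UNIV)" for r
  have Fm[measurable]: "F \<in> borel_measurable E"
  proof -
    interpret sigma_finite_measure "count_space (UNIV :: 'z set)"
      by (rule sigma_finite_measure_count_space)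
    have "(\<lambda>(z, r). f z r) \<in> borel_measurable (count_space UNIV \<Otimes>\<^sub>M E)"
      by (rule measurable_pair_measure_countable1) simp_all
    from measurable_pair_swap[OF this] show ?thesis
      unfolding F_def by (intro borel_measurable_nn_integral) (simp add: case_prod_unfold)
  qed
  \<comment> \<open>The derivatives add up to \<open>1\<close> since the measures \<open>\<nu> z\<close> add up to the image of \<open>P\<close>.\<close>
  have "density ?\<mu> F = density ?\<mu> (\<lambda>_. 1)"
  proof (rule measure_eqI)
    fix A assume "A \<in> sets (density ?\<mu> F)"
    then have A[measurable]: "A \<in> sets E" by simp
    have "emeasure (density ?\<mu> F) A = (\<integral>\<^sup>+r. (\<integral>\<^sup>+z. f z r * indicator A r \<partial>count_space UNIV) \<partial>?\<mu>)"
      using A by (simp add: emeasure_density F_def nn_integral_multc)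
    also have "\<dots> = (\<integral>\<^sup>+z. (\<integral>\<^sup>+r. f z r * indicator A r \<partial>?\<mu>) \<partial>count_space UNIV)"
      by (rule nn_integral_count_space_nn_integral) auto
    also have "\<dots> = (\<integral>\<^sup>+z. emeasure (\<nu> z) A \<partial>count_space UNIV)"
      using A by (intro nn_integral_cong) (simp add: dens[symmetric] emeasure_density)
    also have "\<dots> = (\<integral>\<^sup>+z. (\<integral>\<^sup>+w. indicator A (T w) * indicator {z} (Z w) \<partial>P) \<partial>count_space UNIV)"
      using \<nu>A[OF A] by simp
    also have "\<dots> = (\<integral>\<^sup>+w. (\<integral>\<^sup>+z. indicator A (T w) * indicator {z} (Z w) \<partial>count_space UNIV) \<partial>P)"
      by (rule nn_integral_count_space_nn_integral[symmetric]) auto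
    also have "\<dots> = (\<integral>\<^sup>+w. indicator A (T w) \<partial>P)"
    proof (rule nn_integral_cong)
      fix w
      have "(\<integral>\<^sup>+z. indicator {z} (Z w) \<partial>count_space UNIV) = (\<integral>\<^sup>+z. indicator {Z w} z \<partial>count_space UNIV)"
        by (intro nn_integral_cong) (auto simp: indicator_def)
      then have "(\<integral>\<^sup>+z. indicator {z} (Z w) \<partial>count_space UNIV) = (1 :: ennreal)" by simp
      then show "(\<integral>\<^sup>+z. indicator A (T w) * indicator {z} (Z w) \<partial>count_space UNIV) = (indicator A (T w) :: ennreal)"
        by (simp add: nn_integral_cmult)
    qed
    also have "\<dots> = emeasure ?\<mu> A"
      using A nn_integral_distr[OF T, of "indicator A"] by simp
    finally show "emeasure (density ?\<mu> F) A = emeasure (density ?\<mu> (\<lambda>_. 1)) A"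
      by (simp add: density_1)
  qed simp
  then have F1: "AE r in ?\<mu>. F r = 1"
    by (intro \<mu>.density_unique) auto
  \<comment> \<open>On the null set where the derivatives do not add up to \<open>1\<close>, any fixed distribution will do.\<close>
  define k where "k r = (if F r = 1 then embed_pmf (\<lambda>z. enn2real (f z r)) else return_pmf undefined)" for r
  have f_k: "ennreal (pmf (k r) z) = f z r" if "F r = 1" for r z
  proof -
    have fin: "f z r < \<infinity>" for z
    proof -
      have "f z r \<le> F r" unfolding F_def by (rule nn_integral_ge_point) simp
      then show ?thesis using that by (simp add: le_less_trans)
    qed
    then have eq: "ennreal (enn2real (f z r)) = f z r" for z by simp
    have "pmf (embed_pmf (\<lambda>z. enn2real (f z r))) z = enn2real (f z r)"
      by (rule pmf_embed_pmf) (use that in \<open>auto simp: eq F_def\<close>)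
    then show ?thesis using that eq by (simp add: k_def)
  qed
  have pmf_k: "pmf (k r) z = (if F r = 1 then enn2real (f z r) else indicator {undefined} z)" for r z
  proof (cases "F r = 1")
    case True
    then show ?thesis by (simp flip: f_k)
  qed (simp add: k_def indicator_def)
  show thesis
  proof
    show km: "(\<lambda>r. pmf (k r) z) \<in> borel_measurable E" for z
      unfolding pmf_k by measurable
    fix z and g :: "'e \<Rightarrow> ennreal" assume g[measurable]: "g \<in> borel_measurable E"
    have "(\<integral>\<^sup>+r. g r * ennreal (pmf (k r) z) \<partial>?\<mu>) = (\<integral>\<^sup>+r. f z r * g r \<partial>?\<mu>)"
      using F1 by (intro nn_integral_cong_AE, eventually_elim) (simp add: f_k mult.commute)
    also have "\<dots> = (\<integral>\<^sup>+r. g r \<partial>\<nu> z)"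
      unfolding dens[symmetric] by (rule nn_integral_density[symmetric]) auto
    finally show "(\<integral>\<^sup>+r. g r * ennreal (pmf (k r) z) \<partial>?\<mu>) = (\<integral>\<^sup>+w. g (T w) * indicator {z} (Z w) \<partial>P)"
      using \<nu>[OF g] by simp
  qed
qed

section \<open>Superlevel sets as extreme points\<close>

text \<open>
  The function with value \<open>1 + c\<close> where \<open>u\<close> exceeds the level \<open>s\<close> and value \<open>1\<close> elsewhere. For
  $c = e^\alpha - 1$ it takes its values in $\{1, e^\alpha\}$. The superlevel set is taken inside \<open>X\<close>,
  so the value outside \<open>X\<close> is \<open>1\<close>.
\<close>
definition level_fun :: "'a set \<Rightarrow> real \<Rightarrow> ('a \<Rightarrow> real) \<Rightarrow> real \<Rightarrow> 'a \<Rightarrow> real" where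
  "level_fun X c u s = (\<lambda>x. 1 + c * indicator {y \<in> X. s < u y} x)"

lemma superlevel_sets_lebesgue:
  fixes X :: "'a::euclidean_space set" and u :: "'a \<Rightarrow> real"
  assumes "X \<in> sets lebesgue" "u \<in> borel_measurable (lebesgue_on X)"
  shows "{y \<in> X. s < u y} \<in> sets lebesgue"
proof -
  have "{y \<in> space (lebesgue_on X). s < u y} \<in> sets (lebesgue_on X)"
    using assms(2) by measurable
  then show ?thesis using assms(1) by (simp add: sets_restrict_space_iff)
qed

lemma level_fun_measurable:
  fixes X :: "'a::euclidean_space set"
  assumes "X \<in> sets lebesgue" "u \<in> borel_measurable (lebesgue_on X)"
  shows "level_fun X c u s \<in> borel_measurable (lebesgue_on X)"
proof -
  have "{y \<in> X. s < u y} \<in> sets (lebesgue_on X)"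
    using superlevel_sets_lebesgue[OF assms] assms(1) by (simp add: sets_restrict_space_iff)
  then show ?thesis unfolding level_fun_def by simp
qed

lemma level_class_in_E_set:
  fixes X :: "'a::euclidean_space set"
  assumes "X \<in> sets lebesgue" "u \<in> borel_measurable (lebesgue_on X)"
  shows "ae_class X (level_fun X (exp \<alpha> - 1) u s) \<in> E_set \<alpha> X"
  unfolding E_set_def
  using level_fun_measurable[OF assms, of "exp \<alpha> - 1" s] by (auto simp: level_fun_def indicator_def)

text \<open>
  The exceptional null set of points does not depend on the level \<open>s\<close>. Rational levels on either
  side of \<open>s\<close>, chosen on the same side of \<open>u x\<close> as \<open>s\<close>, squeeze the evaluation at level \<open>s\<close>.
\<close>

lemma AE_eval_at_level_class:
  fixes X :: "'a::euclidean_space set"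
  assumes X: "open X" and u: "u \<in> borel_measurable (lebesgue_on X)" and c: "c \<ge> 0"
  shows "AE x in lebesgue_on X. \<forall>s. s \<noteq> u x \<longrightarrow>
    eval_at X x (ae_class X (level_fun X c u s)) = level_fun X c u s x"
proof -
  have Xl: "X \<in> sets lebesgue" using X by auto
  have "AE x in lebesgue_on X. eval_fun X x (level_fun X c u s) = level_fun X c u s x" for s
    unfolding level_fun_def
    by (rule AE_eval_fun_two_valued[OF X superlevel_sets_lebesgue[OF Xl u]]) auto
  then have "AE x in lebesgue_on X. \<forall>t::rat. eval_fun X x (level_fun X c u (of_rat t)) = level_fun X c u (of_rat t) x"
    by (subst AE_all_countable) blast
  then show ?thesis
    using AE_space
  proof eventually_elim
    fix x assume "\<forall>t::rat. eval_fun X x (level_fun X c u (of_rat t)) = level_fun X c u (of_rat t) x"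
      and "x \<in> space (lebesgue_on X)"
    then have xX: "x \<in> X"
      and rat: "\<And>t::rat. eval_fun X x (level_fun X c u (of_rat t)) = level_fun X c u (of_rat t) x"
      by auto
    have mono: "eval_fun X x (level_fun X c u t) \<le> eval_fun X x (level_fun X c u s)" if "s \<le> t" for s t
      by (rule eval_fun_mono[OF Xl level_fun_measurable[OF Xl u] level_fun_measurable[OF Xl u], where B = "1 + c"])
        (use that c in \<open>auto simp: level_fun_def indicator_def\<close>)
    have "eval_fun X x (level_fun X c u s) = level_fun X c u s x" if s: "s \<noteq> u x" for s
    proof -
      obtain l h :: rat where l: "of_rat l < s" "u x < s \<Longrightarrow> u x < of_rat l"
        and h: "s < of_rat h" "s < u x \<Longrightarrow> of_rat h < u x"
      proof -
        have "(if u x < s then u x else s - 1) < s" by simp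
        from of_rat_dense[OF this] obtain l :: rat
          where "(if u x < s then u x else s - 1) < of_rat l" "of_rat l < s" by blast
        moreover have "s < (if s < u x then u x else s + 1)" by simp
        from of_rat_dense[OF this] obtain h :: rat
          where "s < of_rat h" "of_rat h < (if s < u x then u x else s + 1)" by blast
        ultimately show thesis using that[of l h] by (simp split: if_splits)
      qed
      have "level_fun X c u (of_rat l) x = level_fun X c u s x"
        "level_fun X c u (of_rat h) x = level_fun X c u s x"
        using s l h xX by (cases "s < u x"; auto simp: level_fun_def indicator_def)+
      then show ?thesis
        using mono[of "of_rat l" s] mono[of s "of_rat h"] l(1) h(1) by (simp add: rat)
    qed
    then show "\<forall>s. s \<noteq> u x \<longrightarrow>
        eval_at X x (ae_class X (level_fun X c u s)) = level_fun X c u s x"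
      by (simp add: eval_at_ae_class[OF X level_fun_measurable[OF Xl u]])
  qed
qed

lemma eval_at_level_class_nonneg:
  fixes X :: "'a::euclidean_space set"
  assumes X: "open X" and u: "u \<in> borel_measurable (lebesgue_on X)" and c: "c \<ge> 0"
  shows "0 \<le> eval_at X x (ae_class X (level_fun X c u s))"
proof -
  have Xl: "X \<in> sets lebesgue" using X by auto
  have "eval_fun X x (\<lambda>_. 0) = 0"
    by (simp add: eval_fun_def Limsup_const set_lebesgue_integral_def flip: zero_ereal_def)
  moreover have "eval_fun X x (\<lambda>_. 0) \<le> eval_fun X x (level_fun X c u s)"
    by (rule eval_fun_mono[OF Xl _ level_fun_measurable[OF Xl u], where B = "1 + c"])
      (use c in \<open>auto simp: level_fun_def indicator_def\<close>)
  ultimately show ?thesis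
    by (simp add: eval_at_ae_class[OF X level_fun_measurable[OF Xl u]])
qed

lemma countable_positive_level_sets:
  fixes X :: "'a::euclidean_space set" and u :: "'a \<Rightarrow> real"
  assumes X: "X \<in> sets lebesgue" and u: "u \<in> borel_measurable (lebesgue_on X)"
  obtains D where "countable D" and "\<And>s. s \<notin> D \<Longrightarrow> AE x in lebesgue_on X. u x \<noteq> s"
proof
  let ?M = "\<lambda>n. restrict_space (lebesgue_on X) (ball 0 (real n))"
  let ?D = "\<lambda>n. {s. measure (distr (?M n) borel u) {s} \<noteq> 0}"
  have b: "ball 0 (real n) \<inter> space (lebesgue_on X) \<in> sets (lebesgue_on X)" for n
    using X by (auto simp: sets_restrict_space_iff)
  have fin: "finite_measure (?M n)" for n
  proof
    have "emeasure (?M n) (space (?M n)) = emeasure lebesgue (X \<inter> ball 0 (real n))"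
      using b[of n] X by (subst emeasure_restrict_space)
        (auto simp: space_restrict_space emeasure_restrict_space Int_commute)
    also have "\<dots> \<le> emeasure lebesgue (ball (0 :: 'a) (real n))" by (intro emeasure_mono) auto
    also have "\<dots> < \<infinity>" using fmeasurableD2[of "ball (0 :: 'a) (real n)" lebesgue] by (simp add: less_top)
    finally show "emeasure (?M n) (space (?M n)) \<noteq> \<infinity>" by simp
  qed
  have um: "u \<in> borel_measurable (?M n)" for n
    using u by (rule measurable_restrict_space1)
  have finD: "finite_measure (distr (?M n) borel u)" for n
    using finite_measure.finite_measure_distr[OF fin um] .
  have "countable (?D n)" for n
    by (rule finite_measure.countable_support[OF finD])
  then show "countable (\<Union>n. ?D n)" by blast
  fix s assume s: "s \<notin> (\<Union>n. ?D n)"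
  have "AE x in lebesgue_on X. x \<in> ball 0 (real n) \<longrightarrow> u x \<noteq> s" for n
  proof -
    have "measure (distr (?M n) borel u) {s} = 0" using s by blast
    then have "emeasure (distr (?M n) borel u) {s} = 0"
      using finite_measure.emeasure_eq_measure[OF finD] by simp
    then have "AE y in distr (?M n) borel u. y \<noteq> s"
      by (intro AE_I[where N = "{s}"]) auto
    then have "AE x in ?M n. u x \<noteq> s"
      using um by (subst (asm) AE_distr_iff) auto
    then show ?thesis
      using b[of n] by (subst (asm) AE_restrict_space_iff) auto
  qed
  then have "AE x in lebesgue_on X. \<forall>n. x \<in> ball 0 (real n) \<longrightarrow> u x \<noteq> s"
    by (subst AE_all_countable) blast
  then show "AE x in lebesgue_on X. u x \<noteq> s"
  proof eventually_elim
    fix x assume *: "\<forall>n. x \<in> ball 0 (real n) \<longrightarrow> u x \<noteq> s"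
    obtain n where "norm x < real n" using reals_Archimedean2 by blast
    with * show "u x \<noteq> s" by (auto dest: spec[of _ n])
  qed
qed

text \<open>
  A single real parameter encodes the pair of an index and a level: the integer part \<open>\<lfloor>t\<rfloor>\<close> selects
  the function and the fractional part is the level. This places indices and
  levels together on the real line, where finite Borel measures are inner regular.
\<close>

lemma continuous_map_level_class:
  fixes X :: "'a::euclidean_space set" and U :: "int \<Rightarrow> 'a \<Rightarrow> real"
  assumes \<alpha>: "\<alpha> \<ge> 0" and X: "X \<in> sets lebesgue" and U: "\<And>k. U k \<in> borel_measurable (lebesgue_on X)"
    and D: "\<int> \<subseteq> D" "\<And>t. t \<notin> D \<Longrightarrow> AE x in lebesgue_on X. U \<lfloor>t\<rfloor> x \<noteq> frac t"
  shows "continuous_map (top_of_set (- D)) (E_top \<alpha> X)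
    (\<lambda>t. ae_class X (level_fun X (exp \<alpha> - 1) (U \<lfloor>t\<rfloor>) (frac t)))"
proof (rule continuous_map_into_E_top[OF \<alpha>])
  show "ae_class X (level_fun X (exp \<alpha> - 1) (U \<lfloor>t\<rfloor>) (frac t)) \<in> E_set \<alpha> X" for t
    by (rule level_class_in_E_set[OF X U])
next
  fix g :: "'a \<Rightarrow> real" assume g: "integrable (lebesgue_on X) g"
  let ?c = "exp \<alpha> - 1"
  let ?f = "\<lambda>t. level_fun X ?c (U \<lfloor>t\<rfloor>) (frac t)"
  note gm = borel_measurable_integrable[OF g]
  have fm: "?f t \<in> borel_measurable (lebesgue_on X)" for t
    by (rule level_fun_measurable[OF X U])
  have "continuous_on (- D) (\<lambda>t. \<integral>x. ?f t x * g x \<partial>lebesgue_on X)"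
  proof (rule continuous_on_sequentiallyI)
    fix v :: "nat \<Rightarrow> real" and a assume a: "a \<in> - D" and lim: "v \<longlonglongrightarrow> a"
    have "a \<notin> \<int>" using a D(1) by blast
    have ev: "eventually (\<lambda>i. \<lfloor>v i\<rfloor> = \<lfloor>a\<rfloor>) sequentially"
      using eventually_floor_eq[OF lim \<open>a \<notin> \<int>\<close>] .
    have l2: "(\<lambda>i. frac (v i)) \<longlonglongrightarrow> frac a"
      using continuous_frac[OF \<open>a \<notin> \<int>\<close>] lim by (rule isCont_tendsto_compose)
    show "(\<lambda>i. \<integral>x. ?f (v i) x * g x \<partial>lebesgue_on X) \<longlonglongrightarrow> (\<integral>x. ?f a x * g x \<partial>lebesgue_on X)"
    proof (rule integral_dominated_convergence)
      show "integrable (lebesgue_on X) (\<lambda>x. exp \<alpha> * \<bar>g x\<bar>)" using g by simp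
      show "AE x in lebesgue_on X. norm (?f (v i) x * g x) \<le> exp \<alpha> * \<bar>g x\<bar>" for i
        using \<alpha> by (intro AE_I2) (auto simp: level_fun_def indicator_def abs_mult mult_le_cancel_right1)
      have "AE x in lebesgue_on X. U \<lfloor>a\<rfloor> x \<noteq> frac a" using D(2)[of a] a by simp
      then show "AE x in lebesgue_on X. (\<lambda>i. ?f (v i) x * g x) \<longlonglongrightarrow> ?f a x * g x"
      proof eventually_elim
        fix x assume ne: "U \<lfloor>a\<rfloor> x \<noteq> frac a"
        have "eventually (\<lambda>i. (frac (v i) < U \<lfloor>a\<rfloor> x) = (frac a < U \<lfloor>a\<rfloor> x)) sequentially"
        proof (cases "frac a < U \<lfloor>a\<rfloor> x")
          case True
          then show ?thesis using order_tendstoD(2)[OF l2 True] by (auto elim: eventually_mono)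
        next
          case False
          then have "U \<lfloor>a\<rfloor> x < frac a" using ne by simp
          from order_tendstoD(1)[OF l2 this] show ?thesis by eventually_elim (use False in auto)
        qed
        with ev have "eventually (\<lambda>i. ?f (v i) x * g x = ?f a x * g x) sequentially"
          by eventually_elim (simp add: level_fun_def indicator_def)
        then show "(\<lambda>i. ?f (v i) x * g x) \<longlonglongrightarrow> ?f a x * g x"
          by (rule tendsto_eventually)
      qed
    qed (use fm gm in auto)
  qed
  then show "continuous_map (top_of_set (- D)) euclideanreal
      (\<lambda>y. pairing X g (ae_class X (?f y)))"
    by (simp add: pairing_ae_class[OF level_fun_measurable[OF X U] gm])
qed

text \<open>The layer-cake formula for a single value \<open>b\<close>.\<close>

lemma nn_integral_level_fun:
  fixes b c :: real
  assumes c: "c \<ge> 0" and b: "0 \<le> b" "b \<le> 1"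
  shows "(\<integral>\<^sup>+s. ennreal (1 + c * indicator {s. s < b} s) \<partial>density lborel (indicator {0..1})) = ennreal (1 + c * b)"
proof -
  have "(\<integral>\<^sup>+s. ennreal (1 + c * indicator {s. s < b} s) \<partial>density lborel (indicator {0..1}))
      = (\<integral>\<^sup>+s. indicator {0..1} s * ennreal (1 + c * indicator {s. s < b} s) \<partial>lborel)"
    by (subst nn_integral_density) auto
  also have "\<dots> = (\<integral>\<^sup>+s. indicator {0..1} s + ennreal c * indicator {0..<b} s \<partial>lborel)"
    using c b by (intro nn_integral_cong) (auto simp: indicator_def)
  also have "\<dots> = ennreal (1 + c * b)"
    using c b by (subst nn_integral_add) (auto simp: nn_integral_cmult simp flip: ennreal_mult ennreal_plus ennreal_1)
  finally show ?thesis .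
qed

section \<open>Consequences of local differential privacy\<close>

lemma AE_lebesgue_on_prod_imp:
  fixes X :: "'a::euclidean_space set" and Y :: "'b::euclidean_space set"
  assumes X: "open X" and Y: "open Y" and ae: "AE p in lebesgue_on (X \<times> Y). Q p"
  shows "AE x in lebesgue_on X. AE y in lebesgue_on Y. Q (x, y)"
proof -
  have s: "X \<in> sets lebesgue" "Y \<in> sets lebesgue" "X \<times> Y \<in> sets lebesgue"
    using X Y open_Times[OF X Y] by auto
  have "AE p in lebesgue. p \<in> X \<times> Y \<longrightarrow> Q p"
    using ae s by (simp add: AE_restrict_space_iff)
  then have "AE p in lborel \<Otimes>\<^sub>M lborel. p \<in> X \<times> Y \<longrightarrow> Q p"
    unfolding lborel_prod by (simp add: AE_completion_iff)
  then have "AE x in lborel. AE y in lborel. (x, y) \<in> X \<times> Y \<longrightarrow> Q (x, y)"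
    by (rule lborel_pair.AE_pair)
  then have "AE x in lebesgue. AE y in lebesgue. (x, y) \<in> X \<times> Y \<longrightarrow> Q (x, y)"
    by (simp add: AE_completion_iff)
  then have "AE x in lebesgue. x \<in> X \<longrightarrow> (AE y in lebesgue. y \<in> Y \<longrightarrow> Q (x, y))"
    by eventually_elim (auto elim: eventually_mono)
  then show ?thesis using s by (simp add: AE_restrict_space_iff)
qed

text \<open>The constant is \<open>S / K\<close>, where \<open>S\<close> is the supremum of \<open>f\<close> over the points at which the
  ratio bound holds against almost every other point; if there is no such point, then \<open>M\<close> is
  null.\<close>

lemma AE_bounds_of_ratio_bound:
  fixes f :: "'a \<Rightarrow> real"
  assumes K: "K > 0" and f: "\<And>x. 0 \<le> f x" "\<And>x. f x \<le> B"
    and ae: "AE x in M. AE y in M. f x \<le> K * f y"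
  obtains m where "m \<ge> 0" "AE x in M. m \<le> f x \<and> f x \<le> K * m"
proof (cases "{x. AE y in M. f x \<le> K * f y} = {}")
  case True
  then have "AE x in M. False" using ae by simp
  then have "AE x in M. 0 \<le> f x \<and> f x \<le> K * 0" by (rule eventually_mono) simp
  then show thesis using that[of 0] by blast
next
  case False
  define Y where "Y = {x. AE y in M. f x \<le> K * f y}"
  define S where "S = Sup (f ` Y)"
  have bdd: "bdd_above (f ` Y)" using f(2) by (intro bdd_aboveI[of _ B]) auto
  have le_S: "f x \<le> S" if "x \<in> Y" for x
    unfolding S_def using that bdd by (intro cSup_upper) auto
  have "\<exists>x\<in>Y. S - 1 / Suc n < f x" for n
    using less_cSup_iff[OF _ bdd, of "S - 1 / Suc n"] False by (auto simp: S_def Y_def)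
  then obtain x where x: "\<And>n. x n \<in> Y" "\<And>n. S - 1 / Suc n < f (x n)" by metis
  have "\<And>n. AE y in M. f (x n) \<le> K * f y" using x(1) by (auto simp: Y_def)
  then have "AE y in M. \<forall>n. f (x n) \<le> K * f y" by (subst AE_all_countable) blast
  then have "AE y in M. S \<le> K * f y"
  proof eventually_elim
    fix y assume y: "\<forall>n. f (x n) \<le> K * f y"
    show "S \<le> K * f y"
    proof (rule ccontr)
      assume "\<not> S \<le> K * f y"
      then obtain n :: nat where "1 / Suc n < S - K * f y"
        using nat_approx_posE[of "S - K * f y"] by auto
      then show False using x(2)[of n] y[rule_format, of n] by linarith
    qed
  qed
  moreover have "AE y in M. f y \<le> S" using ae by eventually_elim (simp add: le_S Y_def)
  ultimately have "AE y in M. S / K \<le> f y \<and> f y \<le> K * (S / K)"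
    by eventually_elim (use K in \<open>auto simp: field_simps\<close>)
  moreover have "S / K \<ge> 0"
    using False f(1) le_S K by (auto simp: Y_def intro!: divide_nonneg_pos intro: order_trans)
  ultimately show thesis using that by blast
qed

text \<open>
  The clamping keeps the parameter in $[0,1]$ for every \<open>t\<close>, also outside the stated range. In
  the degenerate cases \<open>m = 0\<close> and \<open>K = 1\<close> the identity holds whatever the parameter is, so the
  value of the division by zero does not matter.
\<close>

lemma affine_parametrization:
  fixes t m K :: real
  assumes "K \<ge> 1" "0 \<le> m" "m \<le> t" "t \<le> K * m"
  shows "t = m * (1 + (K - 1) * max 0 (min 1 ((t / m - 1) / (K - 1))))"
proof (cases "m = 0 \<or> K = 1")
  case False
  then have mK: "m > 0" "K > 1" using assms by auto
  have "0 \<le> (t / m - 1) / (K - 1)" "(t / m - 1) / (K - 1) \<le> 1"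
    using assms mK by (auto simp: field_simps)
  then have "max 0 (min 1 ((t / m - 1) / (K - 1))) = (t / m - 1) / (K - 1)" by simp
  then show ?thesis using mK by (simp add: field_simps)
qed (use assms in auto)

lemma LDP_affine_decomposition:
  fixes X :: "'a::euclidean_space set" and q :: "'a \<Rightarrow> 'z::countable pmf"
  assumes \<alpha>: "\<alpha> \<ge> 0" and X: "open X" and q: "LDP \<alpha> X q"
  obtains m :: "'z \<Rightarrow> real" and u :: "'z \<Rightarrow> 'a \<Rightarrow> real"
  where "\<And>z. m z \<ge> 0" "\<And>z. u z \<in> borel_measurable (lebesgue_on X)" "\<And>z x. 0 \<le> u z x \<and> u z x \<le> 1"
    and "\<And>z. AE x in lebesgue_on X. pmf (q x) z = m z * (1 + (exp \<alpha> - 1) * u z x)"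
    and "ennreal (exp (- \<alpha>)) \<le> (\<integral>\<^sup>+z. ennreal (m z) \<partial>count_space UNIV)"
    and "(\<integral>\<^sup>+z. ennreal (m z) \<partial>count_space UNIV) \<le> 1"
proof (cases "X = {}")
  case True
  \<comment> \<open>All statements about points of \<open>X\<close> are void, but the mass bounds still require some \<open>m\<close>.\<close>
  then have "AE x in lebesgue_on X. P x" for P by (intro AE_I2) simp
  moreover have "exp (- \<alpha>) \<le> 1" using \<alpha> by simp
  ultimately show thesis
    by (intro that[of "pmf (return_pmf undefined)" "\<lambda>_ _. 0"]) (simp_all only: nn_integral_pmf_eq_1, simp_all)
next
  case False
  have qm: "(\<lambda>x. pmf (q x) z) \<in> borel_measurable (lebesgue_on X)" for z
    using q by (simp add: LDP_def randomization_mechanism_def)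
  have "\<exists>m\<ge>0. AE x in lebesgue_on X. m \<le> pmf (q x) z \<and> pmf (q x) z \<le> exp \<alpha> * m" for z
  proof -
    have "AE p in lebesgue_on (X \<times> X). pmf (q (fst p)) z \<le> exp \<alpha> * pmf (q (snd p)) z"
      using q by (simp add: LDP_def case_prod_unfold)
    from AE_lebesgue_on_prod_imp[OF X X this]
    have "AE x in lebesgue_on X. AE y in lebesgue_on X. pmf (q x) z \<le> exp \<alpha> * pmf (q y) z" by simp
    from AE_bounds_of_ratio_bound[OF exp_gt_zero pmf_nonneg pmf_le_1 this] show ?thesis by blast
  qed
  then obtain m where m0: "\<And>z. m z \<ge> 0"
    and mq: "\<And>z. AE x in lebesgue_on X. m z \<le> pmf (q x) z \<and> pmf (q x) z \<le> exp \<alpha> * m z"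
    by metis
  have "AE x in lebesgue_on X. \<forall>z. m z \<le> pmf (q x) z \<and> pmf (q x) z \<le> exp \<alpha> * m z"
    using mq by (subst AE_all_countable) blast
  moreover have "ae_filter (lebesgue_on X) \<noteq> bot"
  proof -
    have "X \<in> sets lebesgue" using X by auto
    moreover have "emeasure lebesgue X \<noteq> 0"
      using open_not_negligible[OF X False] calculation by (simp add: negligible_iff_emeasure0)
    ultimately show ?thesis
      by (simp add: ae_filter_eq_bot_iff emeasure_restrict_space)
  qed
  ultimately obtain x where x: "\<And>z. m z \<le> pmf (q x) z" "\<And>z. pmf (q x) z \<le> exp \<alpha> * m z"
    using eventually_happens' by blast
  define u where "u z x = max 0 (min 1 ((pmf (q x) z / m z - 1) / (exp \<alpha> - 1)))" for z x
  show thesis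
  proof (rule that[of m u])
    show "u z \<in> borel_measurable (lebesgue_on X)" for z
      unfolding u_def using qm[of z] by measurable
    show "AE x in lebesgue_on X. pmf (q x) z = m z * (1 + (exp \<alpha> - 1) * u z x)" for z
      using mq[of z]
    proof eventually_elim
      case (elim x)
      then show ?case
        unfolding u_def using \<alpha> m0[of z] by (intro affine_parametrization) auto
    qed
    have "ennreal (exp (- \<alpha>)) = ennreal (exp (- \<alpha>)) * (\<integral>\<^sup>+z. ennreal (pmf (q x) z) \<partial>count_space UNIV)"
      by (simp add: nn_integral_pmf_eq_1)
    also have "\<dots> = (\<integral>\<^sup>+z. ennreal (exp (- \<alpha>) * pmf (q x) z) \<partial>count_space UNIV)"
      by (simp add: nn_integral_cmult ennreal_mult)
    also have "\<dots> \<le> (\<integral>\<^sup>+z. ennreal (m z) \<partial>count_space UNIV)"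
      using x(2) by (intro nn_integral_mono ennreal_leI) (simp add: exp_minus field_simps)
    finally show "ennreal (exp (- \<alpha>)) \<le> (\<integral>\<^sup>+z. ennreal (m z) \<partial>count_space UNIV)" .
    have "(\<integral>\<^sup>+z. ennreal (m z) \<partial>count_space UNIV) \<le> (\<integral>\<^sup>+z. ennreal (pmf (q x) z) \<partial>count_space UNIV)"
      using x(1) by (intro nn_integral_mono ennreal_leI)
    then show "(\<integral>\<^sup>+z. ennreal (m z) \<partial>count_space UNIV) \<le> 1"
      by (simp add: nn_integral_pmf_eq_1)
  qed (use m0 in \<open>auto simp: u_def\<close>)
qed

section \<open>The factorization\<close>

theorem proposition1:
  fixes \<alpha> :: real
    and X :: "'a::euclidean_space set"
    and q :: "'a \<Rightarrow> 'z::countable pmf"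
  assumes "\<alpha> \<ge> 0"
    and "open X"
    and "LDP \<alpha> X q"
  shows "\<exists>(\<mu> :: ('a \<Rightarrow> real) set measure) (q2 :: ('a \<Rightarrow> real) set \<Rightarrow> 'z pmf).
      radon_measure (E_top \<alpha> X) \<mu> \<and>
      (AE x in lebesgue_on X. has_bochner_integral \<mu> (\<lambda>r. eval_at X x r) 1) \<and>
      randomization_mechanism (borel_of (E_top \<alpha> X)) q2 \<and>
      (\<forall>z. AE x in lebesgue_on X.
         has_bochner_integral (q_mu X \<mu> x) (\<lambda>r. pmf (q2 r) z) (pmf (q x) z) \<and>
         has_bochner_integral \<mu> (\<lambda>r. pmf (q2 r) z * eval_at X x r) (pmf (q x) z)) \<and>
      ennreal (exp (- \<alpha>)) \<le> emeasure \<mu> (E_set \<alpha> X) \<and> emeasure \<mu> (E_set \<alpha> X) \<le> 1"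
proof -
  note \<alpha> = assms(1)
  have Xl: "X \<in> sets lebesgue" using assms(2) by auto
  let ?c = "exp \<alpha> - 1" and ?E = "borel_of (E_top \<alpha> X)"
  have c: "?c \<ge> 0" using \<alpha> by simp
  obtain m :: "'z \<Rightarrow> real" and u :: "'z \<Rightarrow> 'a \<Rightarrow> real" where m0: "\<And>z. m z \<ge> 0"
    and um: "\<And>z. u z \<in> borel_measurable (lebesgue_on X)" and u01: "\<And>z x. 0 \<le> u z x \<and> u z x \<le> 1"
    and q_eq: "\<And>z. AE x in lebesgue_on X. pmf (q x) z = m z * (1 + ?c * u z x)"
    and m_ge: "ennreal (exp (- \<alpha>)) \<le> (\<integral>\<^sup>+z. ennreal (m z) \<partial>count_space UNIV)"
    and m_le: "(\<integral>\<^sup>+z. ennreal (m z) \<partial>count_space UNIV) \<le> 1"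
    by (rule LDP_affine_decomposition[OF assms]) (rule that)

  \<comment> \<open>The parameter space: \<open>z\<close> has weight \<open>m z\<close>, and the level is uniform on the unit interval.\<close>
  define K where "K = density (count_space UNIV) (\<lambda>z. ennreal (m z))"
  define L :: "real measure" where "L = density lborel (indicator {0..1})"
  have K_UNIV: "emeasure K UNIV = (\<integral>\<^sup>+z. ennreal (m z) \<partial>count_space UNIV)"
    by (simp add: K_def emeasure_density)
  have L_UNIV: "emeasure L UNIV = 1" by (simp add: L_def emeasure_density)
  have spK: "space K = UNIV" "sets K = UNIV" and spL: "space L = UNIV" "sets L = sets borel"
    by (simp_all add: K_def L_def)
  interpret K: finite_measure K
    by standard (use K_UNIV m_le in \<open>auto simp: spK top_unique\<close>)
  interpret L: finite_measure L by standard (simp add: spL L_UNIV)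
  interpret KL: pair_sigma_finite K L ..
  define P where "P = K \<Otimes>\<^sub>M L"
  have spP: "space P = UNIV" by (simp add: P_def space_pair_measure spK spL)
  have P_UNIV: "emeasure P UNIV = emeasure K UNIV"
    using L.emeasure_pair_measure_Times[of UNIV K UNIV] by (simp add: P_def spK spL L_UNIV)
  interpret P: finite_measure P
    by standard (use P_UNIV K_UNIV m_le in \<open>auto simp: spP top_unique\<close>)
  have fst_P: "fst \<in> P \<rightarrow>\<^sub>M count_space UNIV"
    unfolding P_def by (rule measurable_compose[OF measurable_fst]) (simp add: measurable_def spK)

  \<comment> \<open>The pair \<open>(z, s)\<close> is encoded as the real number \<open>to_nat z + s\<close>; decoding by integer and
    fractional part fails only at the level \<open>s = 1\<close>, a null set.\<close>
  define j :: "'z \<times> real \<Rightarrow> real" where "j w = real (to_nat (fst w)) + snd w" for w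
  define U where "U k = u (from_nat (nat k))" for k :: int
  define T where "T t = ae_class X (level_fun X ?c (U \<lfloor>t\<rfloor>) (frac t))" for t
  define \<Phi> where "\<Phi> w = T (j w)" for w
  have T_E: "T t \<in> topspace (E_top \<alpha> X)" for t
    unfolding T_def topspace_E_top[OF \<alpha>] U_def by (rule level_class_in_E_set[OF Xl um])
  have \<Phi>_eq: "\<Phi> (z, s) = ae_class X (level_fun X ?c (u z) s)" if "0 \<le> s" "s < 1" for z s
  proof -
    have "\<lfloor>real (to_nat z) + s\<rfloor> = int (to_nat z)" using that by linarith
    then show ?thesis by (simp add: \<Phi>_def T_def j_def U_def frac_def)
  qed
  have "\<exists>D. countable D \<and> (\<forall>s. s \<notin> D \<longrightarrow> (AE x in lebesgue_on X. U k x \<noteq> s))" for k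
    unfolding U_def by (rule countable_positive_level_sets[OF Xl um]) blast
  then obtain Dk where Dk_all: "\<forall>k. countable (Dk k) \<and> (\<forall>s. s \<notin> Dk k \<longrightarrow> (AE x in lebesgue_on X. U k x \<noteq> s))"
    using choice[of "\<lambda>k D. countable D \<and> (\<forall>s. s \<notin> D \<longrightarrow> (AE x in lebesgue_on X. U k x \<noteq> s))"] by blast
  then have Dk: "\<And>k. countable (Dk k)" "\<And>k s. s \<notin> Dk k \<Longrightarrow> AE x in lebesgue_on X. U k x \<noteq> s"
    by blast+
  define D where "D = \<int> \<union> (\<Union>k. (\<lambda>s. of_int k + s) ` Dk k)"
  have D: "countable D" unfolding D_def using Dk(1) by (auto simp: countable_int)
  have contT: "continuous_map (top_of_set (- D)) (E_top \<alpha> X) T"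
    unfolding T_def
  proof (rule continuous_map_level_class[OF \<alpha> Xl])
    fix t assume "t \<notin> D"
    moreover have "t = of_int \<lfloor>t\<rfloor> + frac t" by (simp add: frac_def)
    ultimately have "frac t \<notin> Dk \<lfloor>t\<rfloor>" unfolding D_def by blast
    then show "AE x in lebesgue_on X. U \<lfloor>t\<rfloor> x \<noteq> frac t" by (rule Dk(2))
  qed (auto simp: U_def um D_def)

  have jm: "j \<in> P \<rightarrow>\<^sub>M borel"
  proof -
    have "(\<lambda>w. real (to_nat (fst w))) \<in> P \<rightarrow>\<^sub>M borel"
      using fst_P by (rule measurable_compose) simp
    moreover have "snd \<in> P \<rightarrow>\<^sub>M borel"
      unfolding P_def by (rule measurable_compose[OF measurable_snd]) (simp add: measurable_def spL)
    ultimately show ?thesis unfolding j_def by (rule borel_measurable_add)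
  qed
  define N where "N = distr P borel j"
  have N_fin: "finite_measure N" unfolding N_def by (rule P.finite_measure_distr[OF jm])
  have N0: "emeasure N {t} = 0" for t
  proof -
    have "emeasure N {t} = emeasure P (j -` {t})"
      using spP by (simp add: N_def emeasure_distr[OF jm])
    also have "\<dots> = (\<integral>\<^sup>+z. emeasure L (Pair z -` (j -` {t})) \<partial>K)"
      unfolding P_def using measurable_sets[OF jm, of "{t}"] spP
      by (intro L.emeasure_pair_measure_alt) (simp add: P_def)
    also have "\<dots> = (\<integral>\<^sup>+z. 0 \<partial>K)"
    proof (rule nn_integral_cong)
      fix z
      have "Pair z -` (j -` {t}) = {t - real (to_nat z)}" by (auto simp: j_def)
      then show "emeasure L (Pair z -` (j -` {t})) = 0"
        by (simp add: L_def emeasure_density nn_integral_indicator_singleton)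
    qed
    finally show ?thesis by simp
  qed
  have ND: "emeasure N D = 0"
  proof -
    have "(\<Union>t\<in>D. {t}) \<in> null_sets N"
      using D N0 by (intro null_sets_UN') (auto simp: null_sets_def N_def)
    then show ?thesis by auto
  qed
  have Tm: "T \<in> borel \<rightarrow>\<^sub>M ?E"
    by (rule measurable_borel_of_continuous_off_countable[OF D T_E contT])
  have \<Phi>m: "\<Phi> \<in> P \<rightarrow>\<^sub>M ?E"
    unfolding \<Phi>_def using jm Tm by (rule measurable_compose)
  define \<mu> where "\<mu> = distr P ?E \<Phi>"
  have \<mu>_N: "\<mu> = distr N ?E T"
    unfolding \<mu>_def N_def using Tm jm by (subst distr_distr) (auto simp: comp_def \<Phi>_def[abs_def])
  have radon: "radon_measure (E_top \<alpha> X) \<mu>"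
    unfolding \<mu>_N using N_fin D ND T_E contT Hausdorff_E_top[OF Xl]
    by (intro radon_measure_distr) (simp_all add: N_def)
  have \<mu>_E: "emeasure \<mu> (E_set \<alpha> X) = (\<integral>\<^sup>+z. ennreal (m z) \<partial>count_space UNIV)"
  proof -
    have "E_set \<alpha> X = space ?E" by (simp add: space_borel_of topspace_E_top[OF \<alpha>])
    then have "emeasure \<mu> (E_set \<alpha> X) = emeasure P (\<Phi> -` space ?E \<inter> space P)"
      unfolding \<mu>_def using \<Phi>m by (simp add: emeasure_distr)
    also have "\<Phi> -` space ?E \<inter> space P = UNIV"
      using T_E by (auto simp: spP \<Phi>_def space_borel_of)
    finally show ?thesis by (simp add: P_UNIV K_UNIV)
  qed
  obtain q2 :: "('a \<Rightarrow> real) set \<Rightarrow> 'z pmf" where q2m: "\<And>z. (\<lambda>r. pmf (q2 r) z) \<in> borel_measurable ?E"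
    and q2: "\<And>z g. g \<in> borel_measurable ?E \<Longrightarrow>
      (\<integral>\<^sup>+r. g r * ennreal (pmf (q2 r) z) \<partial>\<mu>) = (\<integral>\<^sup>+w. g (\<Phi> w) * indicator {z} (fst w) \<partial>P)"
    by (rule conditional_pmf_exists[OF P.finite_measure_axioms fst_P \<Phi>m, folded \<mu>_def]) (rule that)

  have em: "(\<lambda>r. eval_at X x r) \<in> borel_measurable ?E" for x
    by (rule borel_measurable_eval_at[OF Xl])
  have e_nonneg: "AE r in \<mu>. 0 \<le> eval_at X x r" for x
  proof -
    have "{r \<in> space ?E. 0 \<le> eval_at X x r} \<in> sets ?E" using em[of x] by measurable
    then show ?thesis
      unfolding \<mu>_def using \<Phi>m
      by (subst AE_distr_iff)
        (auto simp: \<Phi>_def T_def U_def intro!: AE_I2 eval_at_level_class_nonneg assms(2) um c)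
  qed
  \<comment> \<open>For almost every \<open>x\<close>, weighting the parameter measure by the evaluation at \<open>x\<close> turns the
    distribution of the index into \<open>q x\<close>. The cases \<open>h = 1\<close> and \<open>h\<close> the indicator of a point are
    the normalization and the factorization.\<close>
  have good: "AE x in lebesgue_on X. \<forall>h. (\<integral>\<^sup>+w. ennreal (eval_at X x (\<Phi> w)) * h (fst w) \<partial>P)
      = (\<integral>\<^sup>+z. ennreal (pmf (q x) z) * h z \<partial>count_space UNIV)"
  proof -
    have "AE x in lebesgue_on X. \<forall>z s. s \<noteq> u z x \<longrightarrow>
        eval_at X x (ae_class X (level_fun X ?c (u z) s)) = level_fun X ?c (u z) s x"
      using AE_eval_at_level_class[OF assms(2) um c] by (subst AE_all_countable) blast
    moreover have "AE x in lebesgue_on X. \<forall>z. pmf (q x) z = m z * (1 + ?c * u z x)"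
      using q_eq by (subst AE_all_countable) blast
    ultimately show ?thesis
      using AE_space
    proof eventually_elim
      fix x
      assume ev: "\<forall>z s. s \<noteq> u z x \<longrightarrow>
          eval_at X x (ae_class X (level_fun X ?c (u z) s)) = level_fun X ?c (u z) s x"
        and qx: "\<forall>z. pmf (q x) z = m z * (1 + ?c * u z x)" and "x \<in> space (lebesgue_on X)"
      then have xX: "x \<in> X" by simp
      show "\<forall>h. (\<integral>\<^sup>+w. ennreal (eval_at X x (\<Phi> w)) * h (fst w) \<partial>P)
          = (\<integral>\<^sup>+z. ennreal (pmf (q x) z) * h z \<partial>count_space UNIV)"
      proof
        fix h :: "'z \<Rightarrow> ennreal"
        let ?e = "\<lambda>w. ennreal (eval_at X x (\<Phi> w))"
        have eP: "?e \<in> borel_measurable P"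
          using measurable_compose[OF \<Phi>m em[of x]] by simp
        have hP: "(\<lambda>w. h (fst w)) \<in> borel_measurable P"
          using fst_P by (rule measurable_compose) simp
        have inner: "(\<integral>\<^sup>+s. ?e (z, s) \<partial>L) = ennreal (1 + ?c * u z x)" for z
        proof -
          have "AE s in L. ?e (z, s) = ennreal (1 + ?c * indicator {s. s < u z x} s)"
          proof -
            have "AE s in lborel. s \<noteq> u z x \<and> s \<noteq> 1"
              using AE_lborel_singleton[of "u z x"] AE_lborel_singleton[of 1] by eventually_elim simp
            then have "AE s in lborel. 0 < (indicator {0..1} s :: ennreal) \<longrightarrow>
                ?e (z, s) = ennreal (1 + ?c * indicator {s. s < u z x} s)"
              by eventually_elim
                (use ev xX in \<open>auto simp: indicator_def \<Phi>_eq level_fun_def split: if_splits\<close>)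
            then show ?thesis unfolding L_def by (subst AE_density) auto
          qed
          then have "(\<integral>\<^sup>+s. ?e (z, s) \<partial>L) = (\<integral>\<^sup>+s. ennreal (1 + ?c * indicator {s. s < u z x} s) \<partial>L)"
            by (rule nn_integral_cong_AE)
          also have "\<dots> = ennreal (1 + ?c * u z x)"
            unfolding L_def using c u01[of z x] by (intro nn_integral_level_fun) auto
          finally show ?thesis .
        qed
        have eL: "(\<lambda>s. ?e (z, s)) \<in> borel_measurable L" for z
          using eP unfolding P_def by (rule measurable_Pair2) (simp add: spK)
        have "(\<integral>\<^sup>+w. ?e w * h (fst w) \<partial>P) = (\<integral>\<^sup>+z. (\<integral>\<^sup>+s. ?e (z, s) * h z \<partial>L) \<partial>K)"
          using L.nn_integral_fst[of "\<lambda>w. ?e w * h (fst w)" K] eP hP by (simp add: P_def)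
        also have "\<dots> = (\<integral>\<^sup>+z. ennreal (1 + ?c * u z x) * h z \<partial>K)"
          using eL by (simp add: nn_integral_multc inner)
        also have "\<dots> = (\<integral>\<^sup>+z. ennreal (m z) * (ennreal (1 + ?c * u z x) * h z) \<partial>count_space UNIV)"
          unfolding K_def by (rule nn_integral_density) auto
        also have "\<dots> = (\<integral>\<^sup>+z. ennreal (pmf (q x) z) * h z \<partial>count_space UNIV)"
          using m0 c u01 qx by (intro nn_integral_cong) (simp add: ennreal_mult mult.assoc)
        finally show "(\<integral>\<^sup>+w. ?e w * h (fst w) \<partial>P) = (\<integral>\<^sup>+z. ennreal (pmf (q x) z) * h z \<partial>count_space UNIV)" .
      qed
    qed
  qed
  have e_1: "AE x in lebesgue_on X. has_bochner_integral \<mu> (\<lambda>r. eval_at X x r) 1"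
    using good
  proof eventually_elim
    fix x
    assume *: "\<forall>h. (\<integral>\<^sup>+w. ennreal (eval_at X x (\<Phi> w)) * h (fst w) \<partial>P)
        = (\<integral>\<^sup>+z. ennreal (pmf (q x) z) * h z \<partial>count_space UNIV)"
    have "(\<integral>\<^sup>+r. ennreal (eval_at X x r) \<partial>\<mu>) = (\<integral>\<^sup>+w. ennreal (eval_at X x (\<Phi> w)) \<partial>P)"
      unfolding \<mu>_def using em[of x] by (intro nn_integral_distr[OF \<Phi>m]) simp
    also have "\<dots> = ennreal 1"
      using *[rule_format, of "\<lambda>_. 1"] by (simp add: nn_integral_pmf_eq_1)
    finally show "has_bochner_integral \<mu> (\<lambda>r. eval_at X x r) 1"
      using em[of x] e_nonneg by (intro has_bochner_integral_nn_integral) (auto simp: \<mu>_def)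
  qed
  have factorization: "AE x in lebesgue_on X.
      has_bochner_integral (q_mu X \<mu> x) (\<lambda>r. pmf (q2 r) z) (pmf (q x) z) \<and>
      has_bochner_integral \<mu> (\<lambda>r. pmf (q2 r) z * eval_at X x r) (pmf (q x) z)" for z
    using good
  proof eventually_elim
    fix x
    assume *: "\<forall>h. (\<integral>\<^sup>+w. ennreal (eval_at X x (\<Phi> w)) * h (fst w) \<partial>P)
        = (\<integral>\<^sup>+z. ennreal (pmf (q x) z) * h z \<partial>count_space UNIV)"
    have m1: "(\<lambda>r. pmf (q2 r) z) \<in> borel_measurable \<mu>" "(\<lambda>r. eval_at X x r) \<in> borel_measurable \<mu>"
      using q2m em by (auto simp: \<mu>_def)
    have "(\<integral>\<^sup>+r. ennreal (eval_at X x r) * ennreal (pmf (q2 r) z) \<partial>\<mu>)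
        = (\<integral>\<^sup>+w. ennreal (eval_at X x (\<Phi> w)) * indicator {z} (fst w) \<partial>P)"
      using em[of x] by (intro q2) simp
    also have "\<dots> = (\<integral>\<^sup>+z'. ennreal (pmf (q x) z') * indicator {z} z' \<partial>count_space UNIV)"
      using * by blast
    also have "\<dots> = ennreal (pmf (q x) z)"
      by (simp add: nn_integral_indicator_singleton')
    finally have int: "(\<integral>\<^sup>+r. ennreal (eval_at X x r) * ennreal (pmf (q2 r) z) \<partial>\<mu>) = ennreal (pmf (q x) z)" .
    have "has_bochner_integral (q_mu X \<mu> x) (\<lambda>r. pmf (q2 r) z) (pmf (q x) z)"
      unfolding q_mu_def using m1 int
      by (intro has_bochner_integral_nn_integral) (auto simp: nn_integral_density)
    moreover have "has_bochner_integral \<mu> (\<lambda>r. pmf (q2 r) z * eval_at X x r) (pmf (q x) z)"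
    proof (rule has_bochner_integral_nn_integral)
      show "AE r in \<mu>. 0 \<le> pmf (q2 r) z * eval_at X x r"
        using e_nonneg[of x] by eventually_elim simp
      have "(\<integral>\<^sup>+r. ennreal (pmf (q2 r) z * eval_at X x r) \<partial>\<mu>)
          = (\<integral>\<^sup>+r. ennreal (eval_at X x r) * ennreal (pmf (q2 r) z) \<partial>\<mu>)"
        by (intro nn_integral_cong) (simp add: ennreal_mult'' mult.commute)
      then show "(\<integral>\<^sup>+r. ennreal (pmf (q2 r) z * eval_at X x r) \<partial>\<mu>) = ennreal (pmf (q x) z)"
        using int by simp
    qed (use m1 in auto)
    ultimately show "has_bochner_integral (q_mu X \<mu> x) (\<lambda>r. pmf (q2 r) z) (pmf (q x) z) \<and>
        has_bochner_integral \<mu> (\<lambda>r. pmf (q2 r) z * eval_at X x r) (pmf (q x) z)" by blast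
  qed
  show ?thesis
  proof (intro exI conjI allI)
    show "randomization_mechanism ?E q2" using q2m by (simp add: randomization_mechanism_def)
    show "ennreal (exp (- \<alpha>)) \<le> emeasure \<mu> (E_set \<alpha> X)" using m_ge by (simp add: \<mu>_E)
    show "emeasure \<mu> (E_set \<alpha> X) \<le> 1" using m_le by (simp add: \<mu>_E)
  qed (fact radon e_1 factorization)+
qed

end
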